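(* Let $\zeta_{\mathrm{WR}(\mathbb{Z}^2)}(s)=\sum_{\Lambda\in\mathrm{WR}(\mathbb{Z}^2)}(\det(\Lambda))^{-s}=\sum_{u=1}^\infty\mathcal{N}(u)u^{-s}$. Then $\zeta_{\mathrm{WR}(\mathbb{Z}^2)}(s)$ is analytic for all $s\in\mathbb{C}$ with $\Re(s)>1$, and it is bounded from below by a Dirichlet series that has a pole of order $2$ at $s=1$. Moreover, for every real $\varepsilon>0$ there exists a Dirichlet series with a pole of order $2+\varepsilon$ at $s=1$ which bounds $\zeta_{\mathrm{WR}(\mathbb{Z}^2)}(s)$ from above.
   Context: A full-rank lattice $\Lambda\subset\mathbb{R}^2$ has minimum $|\Lambda|=\min_{0\ne x\in\Lambda}\|x\|$ (Euclidean norm) and set of minimal vectors $S(\Lambda)=\{x\in\Lambda:\|x\|=|\Lambda|\}$; it is well-rounded if $S(\Lambda)$ spans $\mathbb{R}^2$. $\mathrm{WR}(\mathbb{Z}^2)$ is the set of all full-rank well-rounded sublattices of $\mathbb{Z}^2$, $\det(\Lambda)>0$ is the covolume, and $\mathcal{N}(u)$ is the number of lattices in $\mathrm{WR}(\mathbb{Z}^2)$ with determinant $u$. A Dirichlet series $\sum_{n\ge1}c_nn^{-s}$ is said to have a pole of order $\mu$ at $s=s_0$, where $\mu,s_0$ are positive real numbers, if $$0<\lim_{s\to s_0^+}|s-s_0|^\mu\sum_{n=1}^\infty|c_nn^{-s}|<\infty$$ (no analytic continuation is implied). A Dirichlet series $\sum c_nn^{-s}$ is bounded from above (respectively, from below)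 by a Dirichlet series $\sum b_nn^{-s}$ if $\sum_{n}|c_nn^{-s}|\le\sum_n|b_nn^{-s}|$ (respectively, $\ge$) for all $s$ with $\Re(s)>1$. *)

theory Defs
  imports "HOL-Analysis.Analysis"
begin

section \<open>Lattices in Euclidean space\<close>

definition integer_lattice :: "(real ^ 'n) set" where
  "integer_lattice = {x. \<forall>i. x $ i \<in> \<int>}"

text \<open>The columns of the matrix form a lattice basis.\<close>

definition lattice_basis :: "real ^ 'n ^ 'n \<Rightarrow> (real ^ 'n) set \<Rightarrow> bool" where
  "lattice_basis A \<Lambda> \<longleftrightarrow> invertible A \<and> \<Lambda> = (\<lambda>x. A *v x) ` integer_lattice"

definition full_rank_lattice :: "(real ^ 'n) set \<Rightarrow> bool" where
  "full_rank_lattice \<Lambda> \<longleftrightarrow> (\<exists>A. lattice_basis A \<Lambda>)"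

definition lattice_det :: "(real ^ 'n) set \<Rightarrow> real" where
  "lattice_det \<Lambda> = (THE d. \<exists>A. lattice_basis A \<Lambda> \<and> d = \<bar>det A\<bar>)"

lemma lattice_basis_change:
  fixes A B :: "real ^ 'n ^ 'n"
  assumes "lattice_basis A \<Lambda>" "lattice_basis B \<Lambda>"
  shows "\<exists>U. A = B ** U \<and> det U \<in> \<int>"
proof -
  have "\<exists>x \<in> integer_lattice. A *v axis j 1 = B *v x" for j :: 'n
  proof -
    have "axis j 1 \<in> (integer_lattice :: (real ^ 'n) set)"
      by (simp add: integer_lattice_def axis_def)
    with assms show ?thesis
      unfolding lattice_basis_def by blast
  qed
  then obtain u where u: "\<And>j. u j \<in> integer_lattice" "\<And>j. A *v axis j 1 = B *v u j"
    by metis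
  define U :: "real ^ 'n ^ 'n" where "U = (\<chi> i j. u j $ i)"
  have "column j A = column j (B ** U)" for j
    using u(2)[of j]
    by (simp add: U_def vec_eq_iff column_def axis_def if_distrib cong: if_cong
        add: matrix_matrix_mult_def matrix_vector_mult_def)
  then have "A = B ** U"
    by (simp add: column_def vec_eq_iff)
  moreover have "det U \<in> \<int>"
    unfolding det_def using u(1)
    by (intro Ints_sum Ints_mult Ints_prod) (auto simp: U_def integer_lattice_def)
  ultimately show ?thesis by blast
qed

lemma lattice_det_eq:
  fixes A :: "real ^ 'n ^ 'n"
  assumes "lattice_basis A \<Lambda>"
  shows "lattice_det \<Lambda> = \<bar>det A\<bar>"
proof -
  have le: "\<bar>det C\<bar> \<le> \<bar>det B\<bar>"
    if C: "lattice_basis C \<Lambda>" and B: "lattice_basis B \<Lambda>" for B C :: "real ^ 'n ^ 'n"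
  proof -
    obtain U where U: "B = C ** U" "det U \<in> \<int>"
      using lattice_basis_change[OF B C] by blast
    have "det B \<noteq> 0"
      using B by (simp add: lattice_basis_def invertible_det_nz)
    with U have "1 \<le> \<bar>det U\<bar>"
      by (auto simp: det_mul intro: Ints_nonzero_abs_ge1)
    then show ?thesis
      using U by (simp add: det_mul abs_mult mult_le_cancel_left1)
  qed
  then show ?thesis
    unfolding lattice_det_def using assms by (intro the_equality) (auto intro: order.antisym)
qed

text \<open>For a lattice the infimum is attained, so it is the minimum.\<close>

definition lattice_min :: "(real ^ 'n) set \<Rightarrow> real" where
  "lattice_min \<Lambda> = Inf (norm ` (\<Lambda> - {0}))"

definition minimal_vectors :: "(real ^ 'n) set \<Rightarrow> (real ^ 'n) set" where
  "minimal_vectors \<Lambda> = {x \<in> \<Lambda>. norm x = lattice_min \<Lambda>}"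

definition well_rounded :: "(real ^ 'n) set \<Rightarrow> bool" where
  "well_rounded \<Lambda> \<longleftrightarrow> span (minimal_vectors \<Lambda>) = UNIV"

section \<open>Dirichlet series\<close>

text \<open>
  A Dirichlet series is given by its coefficients \<open>c 1, c 2, \<dots>\<close>; the value \<open>c 0\<close> is never used.
  The sum of absolute values is taken in the extended nonnegative reals, so that divergence
  means the value \<open>\<infinity>\<close>.
\<close>

definition dirichlet_abs_sum :: "(nat \<Rightarrow> complex) \<Rightarrow> complex \<Rightarrow> ennreal" where
  "dirichlet_abs_sum c s = (\<Sum>n. ennreal (cmod (c (Suc n) * of_nat (Suc n) powr (- s))))"

definition dirichlet_pole :: "(nat \<Rightarrow> complex) \<Rightarrow> real \<Rightarrow> real \<Rightarrow> bool" where
  "dirichlet_pole c \<mu> s0 \<longleftrightarrow> 0 < \<mu> \<and> 0 < s0 \<and>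
     (\<exists>L. 0 < L \<and> L < \<infinity> \<and>
       ((\<lambda>s::real. ennreal (\<bar>s - s0\<bar> powr \<mu>) * dirichlet_abs_sum c (of_real s)) \<longlongrightarrow> L)
         (at_right s0))"

definition dirichlet_bounded_above :: "(nat \<Rightarrow> complex) \<Rightarrow> (nat \<Rightarrow> complex) \<Rightarrow> bool" where
  "dirichlet_bounded_above c b \<longleftrightarrow>
     (\<forall>s. Re s > 1 \<longrightarrow> dirichlet_abs_sum c s \<le> dirichlet_abs_sum b s)"

definition dirichlet_bounded_below :: "(nat \<Rightarrow> complex) \<Rightarrow> (nat \<Rightarrow> complex) \<Rightarrow> bool" where
  "dirichlet_bounded_below c b \<longleftrightarrow>
     (\<forall>s. Re s > 1 \<longrightarrow> dirichlet_abs_sum c s \<ge> dirichlet_abs_sum b s)"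

section \<open>Well-rounded sublattices of the planar integer lattice\<close>

definition WR_Z2 :: "(real ^ 2) set set" where
  "WR_Z2 = {\<Lambda>. full_rank_lattice \<Lambda> \<and> well_rounded \<Lambda> \<and> \<Lambda> \<subseteq> integer_lattice}"

definition WR_count :: "nat \<Rightarrow> nat" where
  "WR_count u = card {\<Lambda> \<in> WR_Z2. lattice_det \<Lambda> = real u}"

definition zeta_WR :: "complex \<Rightarrow> complex" where
  "zeta_WR s = (\<Sum>\<^sub>\<infinity>\<Lambda>\<in>WR_Z2. of_real (lattice_det \<Lambda>) powr (- s))"

end

theory Submission
  imports Defs "HOL-Complex_Analysis.Complex_Analysis" "HOL-Real_Asymp.Real_Asymp"
begin

text \<open>
  The minimal vectors of a well-rounded planar lattice span a rhombus, whose diagonals are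
  orthogonal. A well-rounded sublattice of \<open>\<int>\<^sup>2\<close> therefore has diagonals \<open>k p\<close> and \<open>l J p\<close> with integers
  \<open>k, l\<close>, an integer vector \<open>p\<close> and the quarter turn \<open>J\<close>, and its determinant is \<open>\<bar>k l\<bar> \<bar>p\<bar>\<^sup>2 / 2\<close>.
  Minimality forces \<open>k\<close> and \<open>l\<close> to be of the same order, so the zeta function at a real \<open>s > 1\<close> is, up to
  a factor bounded near 1, at most the square of the sum of \<open>\<bar>v\<bar> powr (-2 s)\<close> over \<open>v \<noteq> 0\<close> in \<open>\<int>\<^sup>2\<close>.
  Conversely, even \<open>k, l\<close> in a fixed range of ratios and primitive \<open>p\<close> in the first quadrant give
  distinct lattices. Cutting the sums over integer vectors into dyadic pieces bounds them by geometric
  series in \<open>4 powr (1 - s)\<close>, and the two bounds are multiples of \<open>(1 - 2 powr (1 - s)) powr (- 2)\<close> near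
  \<open>s = 1\<close>. In particular the upper bound holds with order 2, and so with order \<open>2 + \<epsilon>\<close>.
\<close>

section \<open>Dirichlet series with a prescribed pole\<close>

lemma norm_nat_powr:
  fixes s :: complex
  shows "cmod (of_nat (Suc n) powr (- s)) = real (Suc n) powr (- Re s)"
  using norm_powr_real_powr[of "of_nat (Suc n)" "- s"] by simp

lemma pochhammer_binomial_sums:
  fixes \<mu> x :: real
  assumes "\<bar>x\<bar> < 1"
  shows "(\<lambda>k. pochhammer \<mu> k / fact k * x ^ k) sums (1 - x) powr (- \<mu>)"
proof -
  have "(\<lambda>k. (- \<mu> gchoose k) * (- x) ^ k) sums (1 + - x) powr (- \<mu>)"
    using assms by (intro gen_binomial_real) auto
  moreover have "(- \<mu> gchoose k) * (- x) ^ k = pochhammer \<mu> k / fact k * x ^ k" for k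
  proof -
    have "(- 1 :: real) ^ k * (- 1) ^ k = 1"
      by (simp flip: power_mult_distrib)
    then show ?thesis
      by (simp add: gbinomial_pochhammer power_minus[of x] mult_ac)
  qed
  ultimately show ?thesis by simp
qed

text \<open>
  Supporting the coefficients on \<open>c * 2 ^ k\<close> turns the binomial series for
  \<open>(1 - x) powr (- \<mu>)\<close>, evaluated at \<open>x = 2 powr (1 - s)\<close>, into a Dirichlet series with a pole of
  prescribed order.
\<close>

definition pole_coeff :: "nat \<Rightarrow> real \<Rightarrow> real \<Rightarrow> nat \<Rightarrow> real" where
  "pole_coeff c K \<mu> n = (\<Sum>k | n = c * 2 ^ k. K * 2 ^ k * pochhammer \<mu> k / fact k)"

lemma pole_coeff_power2:
  assumes "0 < c"
  shows "pole_coeff c K \<mu> (c * 2 ^ k) = K * 2 ^ k * pochhammer \<mu> k / fact k"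
proof -
  have "{j. c * (2::nat) ^ k = c * 2 ^ j} = {k}" using assms by auto
  then show ?thesis by (simp add: pole_coeff_def)
qed

lemma pole_coeff_nonneg: "0 < K \<Longrightarrow> 0 < \<mu> \<Longrightarrow> 0 \<le> pole_coeff c K \<mu> n"
  unfolding pole_coeff_def by (intro sum_nonneg divide_nonneg_nonneg mult_nonneg_nonneg)
    (auto simp: pochhammer_pos less_imp_le)

text \<open>The coefficients are nonnegative, so only \<open>Re s\<close> matters. Since
  \<open>2 ^ k * (2 ^ k) powr (- Re s) = x ^ k\<close> with \<open>x = 2 powr (1 - Re s)\<close>,
  the sum is a binomial series. The parameter \<open>c\<close> provides an exponential factor
  \<open>c powr (- Re s)\<close> that can be matched to a given bound.\<close>

lemma dirichlet_abs_sum_pole_coeff: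
  assumes "0 < c" "0 < K" "0 < \<mu>" "1 < Re s"
  shows "dirichlet_abs_sum (\<lambda>n. of_real (pole_coeff c K \<mu> n)) s =
           ennreal (K * real c powr (- Re s) * (1 - 2 powr (1 - Re s)) powr (- \<mu>))"
proof -
  define f where "f n = pole_coeff c K \<mu> (Suc n) * real (Suc n) powr (- Re s)" for n
  \<comment> \<open>\<open>dirichlet_abs_sum\<close> begins with coefficient 1 at index 0, so the
    coefficient at \<open>c * 2 ^ k\<close> has index one less.\<close>
  define g where "g k = c * (2::nat) ^ k - 1" for k
  define x where "x = (2::real) powr (1 - Re s)"
  define C where "C = K * real c powr (- Re s)"
  have Suc_g: "Suc (g k) = c * 2 ^ k" for k using assms by (simp add: g_def)
  have x: "0 < x" "x < 1"
    using assms powr_less_mono[of "1 - Re s" 0 2] by (auto simp: x_def)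
  have "(\<lambda>k. C * (pochhammer \<mu> k / fact k * x ^ k)) sums (C * (1 - x) powr (- \<mu>))"
    using x by (intro sums_mult pochhammer_binomial_sums) auto
  moreover have "C * (pochhammer \<mu> k / fact k * x ^ k) = f (g k)" for k
  proof -
    have "x ^ k = 2 ^ k * (2 ^ k) powr (- Re s)"
      by (simp add: x_def powr_powr powr_add[symmetric] algebra_simps flip: powr_realpow)
    moreover have "f (g k) = K * 2 ^ k * pochhammer \<mu> k / fact k * (real c powr (- Re s) * (2 ^ k) powr (- Re s))"
      unfolding f_def Suc_g pole_coeff_power2[OF assms(1)] by (simp add: powr_mult)
    ultimately show ?thesis by (simp add: C_def)
  qed
  ultimately have "(\<lambda>k. f (g k)) sums (C * (1 - x) powr (- \<mu>))" by simp
  moreover have "strict_mono g"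
    using assms by (intro strict_monoI) (simp add: g_def diff_less_mono Suc_le_eq)
  moreover have "f n = 0" if "n \<notin> range g" for n
  proof -
    have "Suc n \<noteq> c * 2 ^ k" for k
      using that Suc_g[of k] by (metis Suc_inject rangeI)
    then have "{k. Suc n = c * 2 ^ k} = {}" by blast
    then show ?thesis by (simp add: f_def pole_coeff_def)
  qed
  ultimately have f: "f sums (C * (1 - x) powr (- \<mu>))"
    using sums_mono_reindex by blast
  have f_nonneg: "0 \<le> f n" for n
    using pole_coeff_nonneg[OF assms(2,3)] by (simp add: f_def)
  have "dirichlet_abs_sum (\<lambda>n. of_real (pole_coeff c K \<mu> n)) s = (\<Sum>n. ennreal (f n))"
    unfolding dirichlet_abs_sum_def norm_mult norm_nat_powr f_def
    using pole_coeff_nonneg[OF assms(2,3)] by simp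
  also have "\<dots> = ennreal (C * (1 - x) powr (- \<mu>))"
    using f f_nonneg by (intro suminf_ennreal_eq)
  finally show ?thesis by (simp add: x_def C_def)
qed

text \<open>\<open>1 - 2 powr (1 - s)\<close> has a simple zero at \<open>s = 1\<close> with
  derivative \<open>ln 2\<close>, so its power with exponent \<open>- \<mu>\<close> blows up with
  order exactly \<open>\<mu>\<close>.\<close>

lemma dirichlet_pole_pole_coeff:
  assumes "0 < c" "0 < K" "0 < \<mu>"
  shows "dirichlet_pole (\<lambda>n. of_real (pole_coeff c K \<mu> n)) \<mu> 1"
proof -
  let ?f = "\<lambda>s::real. K * real c powr (- s) * ((s - 1) / (1 - 2 powr (1 - s))) powr \<mu>"
  let ?L = "K * real c powr (- 1) * inverse (ln 2) powr \<mu>"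
  have "((\<lambda>s::real. (s - 1) / (1 - 2 powr (1 - s))) \<longlongrightarrow> inverse (ln 2)) (at_right 1)"
    by real_asymp
  then have "(?f \<longlongrightarrow> ?L) (at_right 1)"
    using assms by (intro tendsto_intros) auto
  then have "((\<lambda>s. ennreal (?f s)) \<longlongrightarrow> ennreal ?L) (at_right 1)"
    by (rule tendsto_ennrealI)
  moreover have "\<forall>\<^sub>F s in at_right (1::real). ennreal (?f s) =
      ennreal (\<bar>s - 1\<bar> powr \<mu>) * dirichlet_abs_sum (\<lambda>n. of_real (pole_coeff c K \<mu> n)) (of_real s)"
    using eventually_at_right_less
  proof eventually_elim
    case (elim s)
    have "2 powr (1 - s) < (1::real)"
      using elim powr_less_mono[of "1 - s" 0 2] by simp
    with elim have "((s - 1) / (1 - 2 powr (1 - s))) powr \<mu> =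
        (s - 1) powr \<mu> * (1 - 2 powr (1 - s)) powr (- \<mu>)"
      by (simp only: powr_divide powr_minus_divide) simp
    with elim assms show ?case
      by (simp add: dirichlet_abs_sum_pole_coeff mult_ac flip: ennreal_mult)
  qed
  ultimately have lim: "((\<lambda>s::real. ennreal (\<bar>s - 1\<bar> powr \<mu>) *
      dirichlet_abs_sum (\<lambda>n. of_real (pole_coeff c K \<mu> n)) (of_real s)) \<longlongrightarrow> ennreal ?L) (at_right 1)"
    by (rule Lim_transform_eventually)
  have "0 < ennreal ?L"
    using assms by simp
  with assms lim show ?thesis
    unfolding dirichlet_pole_def by (intro conjI exI[of _ "ennreal ?L"]) auto
qed

section \<open>Dyadic estimates\<close>

text \<open>Level \<open>j\<close> has \<open>4 ^ j\<close> points of equal weight and contributes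
  one term of a geometric series with ratio \<open>4 powr (1 - \<sigma>)\<close>.\<close>

lemma finite_sum_Sigma_dyadic:
  fixes \<sigma> c :: real
  assumes "0 < c"
  shows "(\<Sum>(j, r, t)\<in>(SIGMA j:{..<J}. {..<2 ^ j :: nat} \<times> {..<2 ^ j :: nat}). (c * 4 ^ j) powr (- \<sigma>)) =
    c powr (- \<sigma>) * (\<Sum>j<J. (4 powr (1 - \<sigma>)) ^ j)"
proof -
  have "4 ^ j * (c * 4 ^ j) powr (- \<sigma>) = c powr (- \<sigma>) * (4 powr (1 - \<sigma>)) ^ j" for j :: nat
  proof -
    have "(4 powr (1 - \<sigma>)) ^ j = 4 ^ j * (4 ^ j) powr (- \<sigma>)"
      by (simp add: powr_powr powr_add[symmetric] algebra_simps flip: powr_realpow)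
    then show ?thesis using assms by (simp add: powr_mult)
  qed
  moreover have "real ((2::nat) ^ j * 2 ^ j) = 4 ^ j" for j
    by (simp flip: power_mult_distrib)
  moreover have "(\<Sum>(j, r, t)\<in>(SIGMA j:{..<J}. {..<2 ^ j :: nat} \<times> {..<2 ^ j :: nat}). (c * 4 ^ j) powr (- \<sigma>)) =
      (\<Sum>j<J. \<Sum>p\<in>{..<2 ^ j :: nat} \<times> {..<2 ^ j :: nat}. (c * 4 ^ j) powr (- \<sigma>))"
    by (subst sum.Sigma) (auto simp: split_def)
  ultimately show ?thesis
    by (simp add: sum_distrib_left)
qed

lemma geometric_sum_bound:
  fixes x :: real
  assumes "0 \<le> x" "x < 1"
  shows "(\<Sum>j<J. x ^ j) \<le> 1 / (1 - x)"
  using assms sum_gp_strict[of x J] by (auto simp: divide_right_mono)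

lemma finite_int_square_less:
  "finite {(a::int, b::int). a\<^sup>2 + b\<^sup>2 < 4 ^ j}" (is ?fin)
  "card {(a::int, b::int). a\<^sup>2 + b\<^sup>2 < 4 ^ j} \<le> 4 * 4 ^ j" (is ?card)
proof -
  let ?I = "{- (2 ^ j) ..< 2 ^ j :: int}"
  have "x \<in> ?I" if "x\<^sup>2 + y\<^sup>2 < 4 ^ j" for x y :: int
  proof -
    have "(2 ^ j)\<^sup>2 = (4 ^ j :: int)"
      by (simp add: power2_eq_square flip: power_mult_distrib)
    with that zero_le_power2[of y] have "\<bar>x\<bar>\<^sup>2 < (2 ^ j)\<^sup>2"
      unfolding power2_abs by linarith
    then have "\<bar>x\<bar> < 2 ^ j" by (rule power2_less_imp_less) simp
    then show ?thesis by auto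
  qed
  from this have sub: "{(a::int, b::int). a\<^sup>2 + b\<^sup>2 < 4 ^ j} \<subseteq> ?I \<times> ?I"
    by (fastforce simp: add.commute)
  then show ?fin by (rule finite_subset) auto
  have "card {(a::int, b::int). a\<^sup>2 + b\<^sup>2 < 4 ^ j} \<le> card (?I \<times> ?I)"
    using sub by (intro card_mono) auto
  also have "\<dots> = 4 * 4 ^ j"
  proof -
    have "2 ^ j - - (2 ^ j) = int (2 * 2 ^ j)" by simp
    then have "card ?I = 2 * 2 ^ j" by (simp only: card_atLeastLessThan_int nat_int)
    then show ?thesis by (simp add: card_cartesian_product flip: power_mult_distrib)
  qed
  finally show ?card .
qed

lemma int_square_class:
  fixes a b :: int
  assumes "(a, b) \<noteq> (0, 0)"
  obtains j :: nat where "4 ^ j \<le> a\<^sup>2 + b\<^sup>2" "a\<^sup>2 + b\<^sup>2 < 4 ^ Suc j"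
proof -
  have "0 < a\<^sup>2 + b\<^sup>2"
    using assms by (simp add: sum_power2_gt_zero_iff)
  then have "1 \<le> nat (a\<^sup>2 + b\<^sup>2)" by linarith
  then obtain j where "4 ^ j \<le> nat (a\<^sup>2 + b\<^sup>2)" "nat (a\<^sup>2 + b\<^sup>2) < 4 ^ (j + 1)"
    using ex_power_ivl1[of 4 "nat (a\<^sup>2 + b\<^sup>2)"] by auto
  then have "4 ^ j \<le> a\<^sup>2 + b\<^sup>2" "a\<^sup>2 + b\<^sup>2 < 4 ^ Suc j"
    by (simp_all add: le_nat_iff nat_less_iff)
  then show thesis by (rule that)
qed

text \<open>The shell between radii \<open>2 ^ j\<close> and \<open>2 ^ Suc j\<close> has at most
  \<open>16 * 4 ^ j\<close> integer points, each of weight at most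
  \<open>(4 ^ j) powr (- \<sigma>)\<close>, and the shells add up to a geometric series. The bound
  does not depend on \<open>V\<close>, which later yields summability.\<close>

lemma sum_int_square_powr_le:
  fixes V :: "(int \<times> int) set" and \<sigma> :: real
  assumes "finite V" "(0, 0) \<notin> V" "1 < \<sigma>"
  shows "(\<Sum>(a, b)\<in>V. real_of_int (a\<^sup>2 + b\<^sup>2) powr (- \<sigma>)) \<le> 16 / (1 - 4 powr (1 - \<sigma>))"
proof -
  define C where "C j = {(a::int, b::int). 4 ^ j \<le> a\<^sup>2 + b\<^sup>2 \<and> a\<^sup>2 + b\<^sup>2 < 4 ^ Suc j}" for j :: nat
  have fin: "finite (C j)" for j
    by (rule finite_subset[OF _ finite_int_square_less(1)[of "Suc j"]]) (auto simp: C_def)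
  have card: "real (card (C j)) \<le> 16 * 4 ^ j" for j
  proof -
    have "card (C j) \<le> card {(a::int, b::int). a\<^sup>2 + b\<^sup>2 < 4 ^ Suc j}"
      by (intro card_mono finite_int_square_less) (auto simp: C_def)
    also have "\<dots> \<le> 16 * 4 ^ j"
      using finite_int_square_less(2)[of "Suc j"] by simp
    finally show ?thesis
      by (metis of_nat_le_iff of_nat_mult of_nat_numeral of_nat_power)
  qed
  have "\<forall>v\<in>V. \<exists>j. v \<in> C j"
  proof
    fix v assume "v \<in> V"
    then have "(fst v, snd v) \<noteq> (0, 0)" using assms by auto
    then show "\<exists>j. v \<in> C j"
      by (rule int_square_class) (auto simp: C_def split_def)
  qed
  then obtain c where c: "\<And>v. v \<in> V \<Longrightarrow> v \<in> C (c v)" by metis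
  obtain J where J: "c ` V \<subseteq> {..<J}"
    using finite_nat_bounded[of "c ` V"] assms by auto
  let ?f = "\<lambda>(a, b). real_of_int (a\<^sup>2 + b\<^sup>2) powr (- \<sigma>)"
  have f: "?f v \<le> (4 ^ j) powr (- \<sigma>)" if "v \<in> C j" for v j
  proof -
    obtain a b where v: "v = (a, b)" by fastforce
    have "real_of_int (4 ^ j) \<le> real_of_int (a\<^sup>2 + b\<^sup>2)"
      using that by (simp only: of_int_le_iff) (auto simp: C_def v)
    then show ?thesis
      using assms by (auto simp: v intro!: powr_mono2')
  qed
  have f_nonneg: "0 \<le> ?f v" for v by (simp add: split_def)
  have "sum ?f V = (\<Sum>j<J. sum ?f {v \<in> V. c v = j})"
    using J assms by (intro sum.group[symmetric]) auto
  also have "\<dots> \<le> (\<Sum>j<J. sum ?f (C j))"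
    using c fin f_nonneg by (intro sum_mono sum_mono2) auto
  also have "\<dots> \<le> (\<Sum>j<J. 16 * (4 powr (1 - \<sigma>)) ^ j)"
  proof (rule sum_mono)
    fix j
    have "sum ?f (C j) \<le> real (card (C j)) * (4 ^ j) powr (- \<sigma>)"
      using f by (intro sum_bounded_above) auto
    also have "\<dots> \<le> (16 * 4 ^ j) * (4 ^ j) powr (- \<sigma>)"
      using card by (intro mult_right_mono) auto
    also have "\<dots> = 16 * (4 powr (1 - \<sigma>)) ^ j"
      by (simp add: powr_powr powr_add[symmetric] algebra_simps flip: powr_realpow)
    finally show "sum ?f (C j) \<le> 16 * (4 powr (1 - \<sigma>)) ^ j" .
  qed
  also have "\<dots> \<le> 16 * (1 / (1 - 4 powr (1 - \<sigma>)))"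
    using assms powr_less_mono[of "1 - \<sigma>" 0 4]
    unfolding sum_distrib_left[symmetric] by (intro mult_left_mono geometric_sum_bound) auto
  finally show ?thesis by simp
qed

text \<open>The unit square with lower left corner \<open>(A, B)\<close>, scaled by
  \<open>2 ^ j\<close>, holds \<open>4 ^ j\<close> integer points of weight at least
  \<open>(c * 4 ^ j) powr (- \<sigma>)\<close>. Different scales give disjoint squares, so the
  contributions add up.\<close>

lemma sum_dyadic_square_ge:
  fixes \<sigma> c :: real and A B :: int and h :: "int \<Rightarrow> int \<Rightarrow> real" and X :: "(int \<times> int) set"
  assumes "finite X" "0 < c" "0 \<le> \<sigma>"
    and mem: "\<And>a b j. A * 2 ^ j \<le> a \<Longrightarrow> a < (A + 1) * 2 ^ j \<Longrightarrow> B * 2 ^ j \<le> b \<Longrightarrow> b < (B + 1) * 2 ^ j \<Longrightarrow>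
      j < J \<Longrightarrow> (a, b) \<in> X"
    and h: "\<And>a b j. A * 2 ^ j \<le> a \<Longrightarrow> a < (A + 1) * 2 ^ j \<Longrightarrow> B * 2 ^ j \<le> b \<Longrightarrow> b < (B + 1) * 2 ^ j \<Longrightarrow>
      0 < h a b \<and> h a b \<le> c * 4 ^ j"
    and "1 \<le> A"
  shows "c powr (- \<sigma>) * (\<Sum>j<J. (4 powr (1 - \<sigma>)) ^ j) \<le> (\<Sum>(a, b)\<in>X. h a b powr (- \<sigma>))"
proof -
  define S where "S = (SIGMA j:{..<J}. {..<2 ^ j :: nat} \<times> {..<2 ^ j :: nat})"
  define e where "e = (\<lambda>(j, r, t). (A * 2 ^ j + int r, B * 2 ^ j + int t))"
  have box: "A * 2 ^ j \<le> A * 2 ^ j + int r" "A * 2 ^ j + int r < (A + 1) * 2 ^ j"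
     "B * 2 ^ j \<le> B * 2 ^ j + int t" "B * 2 ^ j + int t < (B + 1) * 2 ^ j"
     if "(j, r, t) \<in> S" for j r t
  proof -
    have "int r < int (2 ^ j)" "int t < int (2 ^ j)"
      unfolding of_nat_less_iff using that by (auto simp: S_def)
    then show "A * 2 ^ j \<le> A * 2 ^ j + int r" "A * 2 ^ j + int r < (A + 1) * 2 ^ j"
     "B * 2 ^ j \<le> B * 2 ^ j + int t" "B * 2 ^ j + int t < (B + 1) * 2 ^ j"
      by (auto simp: algebra_simps)
  qed
  have "inj_on e S"
  proof (rule inj_onI)
    \<comment> \<open>The first coordinate alone separates the levels: for \<open>j' < j\<close> it
      is below \<open>(A + 1) * 2 ^ j'\<close> at level \<open>j'\<close>, and
      \<open>(A + 1) * 2 ^ j' \<le> A * 2 ^ j\<close> because \<open>1 \<le> A\<close>.\<close>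
    have le: "j \<le> j'" if "(j, r, t) \<in> S" "(j', r', t') \<in> S" "A * 2 ^ j + int r = A * 2 ^ j' + int r'"
      for j j' r r' t t'
    proof (rule ccontr)
      assume "\<not> j \<le> j'"
      then have "(2::int) ^ Suc j' \<le> 2 ^ j" by (intro power_increasing) auto
      have "A * 2 ^ Suc j' \<le> A * 2 ^ j"
        using \<open>2 ^ Suc j' \<le> 2 ^ j\<close> \<open>1 \<le> A\<close> by (intro mult_left_mono) auto
      moreover have "(A + 1) * 2 ^ j' \<le> (2 * A) * 2 ^ j'"
        using \<open>1 \<le> A\<close> by (intro mult_right_mono) auto
      ultimately show False
        using box[OF that(1)] box[OF that(2)] that(3) by (simp add: mult.assoc mult.left_commute)
    qed
    fix x y assume xy: "x \<in> S" "y \<in> S" "e x = e y"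
    obtain j r t j' r' t' where eq: "x = (j, r, t)" "y = (j', r', t')"
      by (metis prod_cases3)
    with xy le[of j r t j' r' t'] le[of j' r' t' j r t] have "j = j'"
      by (simp add: e_def)
    with xy eq show "x = y" by (simp add: e_def)
  qed
  have "c powr (- \<sigma>) * (\<Sum>j<J. (4 powr (1 - \<sigma>)) ^ j) = (\<Sum>(j, r, t)\<in>S. (c * 4 ^ j) powr (- \<sigma>))"
    unfolding S_def by (rule finite_sum_Sigma_dyadic[symmetric]) fact
  also have "\<dots> \<le> (\<Sum>x\<in>S. case e x of (a, b) \<Rightarrow> h a b powr (- \<sigma>))"
  proof (rule sum_mono)
    fix x assume "x \<in> S"
    then obtain j r t where x: "x = (j, r, t)" "(j, r, t) \<in> S"
      by (metis prod_cases3)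
    from h[OF box[OF x(2)]] assms show "(case x of (j, r, t) \<Rightarrow> (c * 4 ^ j) powr (- \<sigma>)) \<le>
        (case e x of (a, b) \<Rightarrow> h a b powr (- \<sigma>))"
      by (auto simp: x(1) e_def intro!: powr_mono2')
  qed
  also have "\<dots> = (\<Sum>(a, b)\<in>e ` S. h a b powr (- \<sigma>))"
    using \<open>inj_on e S\<close> by (simp add: sum.reindex)
  also have "\<dots> \<le> (\<Sum>(a, b)\<in>X. h a b powr (- \<sigma>))"
  proof (rule sum_mono2)
    show "e ` S \<subseteq> X"
    proof (rule image_subsetI)
      fix x assume "x \<in> S"
      then obtain j r t where x: "x = (j, r, t)" "(j, r, t) \<in> S"
        by (metis prod_cases3)
      then have "j < J" by (simp add: S_def)
      with mem[OF box[OF x(2)]] show "e x \<in> X" by (simp add: x(1) e_def)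
    qed
  qed (use assms in auto)
  finally show ?thesis .
qed

lemma sum_inverse_squares_le: "(\<Sum>g = 1..N. 1 / (real g)\<^sup>2) \<le> 2"
proof -
  \<comment> \<open>The stronger bound with \<open>- 1 / real (Suc N)\<close> makes the induction
    telescope.\<close>
  have "(\<Sum>g = 1..Suc N. 1 / (real g)\<^sup>2) \<le> 2 - 1 / real (Suc N)" for N
  proof (induction N)
    case (Suc N)
    have "1 / (real (Suc (Suc N)))\<^sup>2 \<le> 1 / real (Suc N) - 1 / real (Suc (Suc N))"
      by (simp add: diff_frac_eq frac_le power2_eq_square)
    with Suc show ?case by simp
  qed simp
  from this[of "N - 1"] show ?thesis
    by (cases N) (auto intro: order_trans)
qed

section \<open>Planar well-rounded lattices\<close>

text \<open>The determinant of the pair. Linear independence is used throughout in the form that it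
  does not vanish.\<close>

definition cross :: "real ^ 2 \<Rightarrow> real ^ 2 \<Rightarrow> real" where
  "cross x y = x $ 1 * y $ 2 - x $ 2 * y $ 1"

definition lat :: "real ^ 2 \<Rightarrow> real ^ 2 \<Rightarrow> (real ^ 2) set" where
  "lat x y = {of_int i *\<^sub>R x + of_int j *\<^sub>R y | i j. True}"

lemma norm_power2_vec2: "(norm (x :: real ^ 2))\<^sup>2 = (x $ 1)\<^sup>2 + (x $ 2)\<^sup>2"
  by (simp only: power2_norm_eq_inner inner_vec_def sum_2) (simp add: power2_eq_square)

lemma cramer_vec2:
  assumes "cross x y \<noteq> 0"
  shows "z = (cross z y / cross x y) *\<^sub>R x + (cross x z / cross x y) *\<^sub>R y"
  using assms by (simp add: vec_eq_iff forall_2 field_simps) (simp add: cross_def algebra_simps)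

lemma lat_basis:
  assumes "cross x y \<noteq> 0"
  defines "A \<equiv> \<chi> i j. if j = 1 then x $ i else y $ i"
  shows "lattice_basis A (lat x y)" "det A = cross x y"
proof -
  have mult: "A *v z = z $ 1 *\<^sub>R x + z $ 2 *\<^sub>R y" for z
    by (simp add: A_def vec_eq_iff matrix_vector_mult_def sum_2 mult.commute)
  show det: "det A = cross x y"
    by (simp add: det_2 A_def cross_def)
  have "lat x y = (\<lambda>z. A *v z) ` integer_lattice"
  proof (intro equalityI subsetI)
    fix z assume "z \<in> lat x y"
    then obtain i j where z: "z = of_int i *\<^sub>R x + of_int j *\<^sub>R y"
      by (auto simp: lat_def)
    have "vector [of_int i, of_int j] \<in> (integer_lattice :: (real ^ 2) set)"
      by (simp add: integer_lattice_def forall_2)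
    moreover have "z = A *v vector [of_int i, of_int j]"
      by (simp add: mult z)
    ultimately show "z \<in> (\<lambda>z. A *v z) ` integer_lattice" by blast
  next
    fix z assume "z \<in> (\<lambda>z. A *v z) ` integer_lattice"
    then obtain w where "w \<in> integer_lattice" "z = A *v w" by blast
    then show "z \<in> lat x y"
      by (simp add: lat_def mult integer_lattice_def forall_2) (metis Ints_cases)
  qed
  then show "lattice_basis A (lat x y)"
    using assms(1) det by (simp add: lattice_basis_def invertible_det_nz)
qed

lemma lattice_det_lat: "cross x y \<noteq> 0 \<Longrightarrow> lattice_det (lat x y) = \<bar>cross x y\<bar>"
  by (simp add: lattice_det_eq[OF lat_basis(1)] lat_basis(2))

lemma full_rank_lattice_lat: "cross x y \<noteq> 0 \<Longrightarrow> full_rank_lattice (lat x y)"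
  using lat_basis(1) full_rank_lattice_def by blast

lemma full_rank_latticeE:
  fixes \<Lambda> :: "(real ^ 'n) set"
  assumes "full_rank_lattice \<Lambda>"
  obtains A :: "real ^ 'n ^ 'n" where "\<Lambda> = (\<lambda>x. A *v x) ` integer_lattice"
  using assms unfolding full_rank_lattice_def lattice_basis_def by (elim exE conjE) (rule that)

lemma full_rank_lattice_combination:
  fixes \<Lambda> :: "(real ^ 'n) set"
  assumes "full_rank_lattice \<Lambda>" "x \<in> \<Lambda>" "y \<in> \<Lambda>" "z \<in> \<Lambda>"
  shows "z + of_int i *\<^sub>R x + of_int j *\<^sub>R y \<in> \<Lambda>"
proof -
  obtain A :: "real ^ 'n ^ 'n" where A: "\<Lambda> = (\<lambda>x. A *v x) ` integer_lattice"
    using assms(1) by (rule full_rank_latticeE)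
  obtain u where u: "u \<in> integer_lattice" "x = A *v u"
    using assms(2) unfolding A by (rule imageE)
  obtain v where v: "v \<in> integer_lattice" "y = A *v v"
    using assms(3) unfolding A by (rule imageE)
  obtain w where w: "w \<in> integer_lattice" "z = A *v w"
    using assms(4) unfolding A by (rule imageE)
  have "w + of_int i *\<^sub>R u + of_int j *\<^sub>R v \<in> integer_lattice"
    using u v w by (simp add: integer_lattice_def)
  moreover have "z + of_int i *\<^sub>R x + of_int j *\<^sub>R y = A *v (w + of_int i *\<^sub>R u + of_int j *\<^sub>R v)"
    by (simp add: u v w matrix_vector_right_distrib matrix_vector_mult_scaleR)
  ultimately show ?thesis unfolding A by (rule rev_image_eqI)
qed

lemma zero_in_full_rank_lattice:
  fixes \<Lambda> :: "(real ^ 'n) set"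
  assumes "full_rank_lattice \<Lambda>"
  shows "0 \<in> \<Lambda>"
proof -
  obtain A :: "real ^ 'n ^ 'n" where A: "\<Lambda> = (\<lambda>x. A *v x) ` integer_lattice"
    using assms by (rule full_rank_latticeE)
  have "0 \<in> integer_lattice" by (simp add: integer_lattice_def)
  then show ?thesis unfolding A by (rule rev_image_eqI) simp
qed

section \<open>Independent minimal vectors form a basis\<close>

text \<open>If \<open>cross x\<close> vanished on all minimal vectors, it would vanish on their
  span, which is the whole plane. For \<open>x \<noteq> 0\<close> this fails at the quarter turn of
  \<open>x\<close>, where \<open>cross\<close> takes the squared norm of \<open>x\<close> as
  value.\<close>

lemma well_rounded_independent:
  fixes \<Lambda> :: "(real ^ 2) set"
  assumes "well_rounded \<Lambda>"
  obtains x y where "x \<in> minimal_vectors \<Lambda>" "y \<in> minimal_vectors \<Lambda>" "cross x y \<noteq> 0"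
proof -
  let ?S = "minimal_vectors \<Lambda>"
  have span: "span ?S = UNIV"
    using assms by (simp add: well_rounded_def)
  have *: "?S \<subseteq> {y. cross x y = 0} \<Longrightarrow> cross x y = 0" for x y
  proof -
    assume "?S \<subseteq> {y. cross x y = 0}"
    moreover have "subspace {y. cross x y = 0}"
      by (auto simp: subspace_def cross_def algebra_simps)
    ultimately have "span ?S \<subseteq> {y. cross x y = 0}" by (rule span_minimal)
    then show ?thesis using span by auto
  qed
  obtain x where x: "x \<in> ?S" "x \<noteq> 0"
  proof -
    have "\<not> ?S \<subseteq> {0}"
    proof
      assume "?S \<subseteq> {0}"
      then have "span ?S \<subseteq> {0 :: real ^ 2}" by (rule span_minimal) auto
      with span have "(1 :: real ^ 2) = 0" by auto
      then show False by simp
    qed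
    with that show thesis by blast
  qed
  have "cross x (vector [- x $ 2, x $ 1]) \<noteq> 0"
    using x(2) by (simp add: cross_def vec_eq_iff forall_2 sum_squares_eq_zero_iff)
  with * x(1) that show thesis by blast
qed

lemma lattice_min_le:
  assumes "z \<in> \<Lambda>" "z \<noteq> 0"
  shows "lattice_min \<Lambda> \<le> norm z"
  unfolding lattice_min_def using assms
  by (intro cInf_lower) (auto intro!: bdd_belowI[of _ 0])

text \<open>
  Reducing modulo \<open>x, y\<close> leaves a lattice vector \<open>p x + q y\<close> with \<open>\<bar>p\<bar>, \<bar>q\<bar> \<le> 1/2\<close>, whose squared norm is
  at most three quarters of the minimum.
\<close>

lemma minimal_vectors_generate:
  fixes \<Lambda> :: "(real ^ 2) set"
  assumes \<Lambda>: "full_rank_lattice \<Lambda>" and x: "x \<in> minimal_vectors \<Lambda>" and y: "y \<in> minimal_vectors \<Lambda>"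
    and "cross x y \<noteq> 0"
  shows "\<Lambda> = lat x y" "2 * \<bar>x \<bullet> y\<bar> \<le> (norm x)\<^sup>2"
proof -
  have mem: "x \<in> \<Lambda>" "y \<in> \<Lambda>" and N: "norm y = norm x" "norm x = lattice_min \<Lambda>"
    using x y by (auto simp: minimal_vectors_def)
  have "x \<noteq> 0" using assms(4) by (auto simp: cross_def)
  have min: "(norm x)\<^sup>2 \<le> (norm z)\<^sup>2" if "z \<in> \<Lambda>" "z \<noteq> 0" for z
    using lattice_min_le[OF that] N by (metis norm_ge_zero power_mono)
  have comb: "z + of_int i *\<^sub>R x + of_int j *\<^sub>R y \<in> \<Lambda>" if "z \<in> \<Lambda>" for z i j
    using \<Lambda> mem that by (rule full_rank_lattice_combination)
  \<comment> \<open>Neither diagonal of the rhombus is shorter than its sides, so the angle between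
    \<open>x\<close> and \<open>y\<close> has cosine at most 1/2 in absolute value.\<close>
  have "x + y \<in> \<Lambda>" "x - y \<in> \<Lambda>"
    using comb[OF mem(1), of 0 1] comb[OF mem(1), of 0 "-1"] by simp_all
  moreover have "x + y \<noteq> 0" "x - y \<noteq> 0"
    using assms(4) by (auto simp: cross_def eq_neg_iff_add_eq_0[symmetric])
  ultimately have "(norm x)\<^sup>2 \<le> (norm (x + y))\<^sup>2" "(norm x)\<^sup>2 \<le> (norm (x - y))\<^sup>2"
    using min by blast+
  moreover have "(norm (x + y))\<^sup>2 = (norm x)\<^sup>2 + (norm y)\<^sup>2 + 2 * (x \<bullet> y)"
     "(norm (x - y))\<^sup>2 = (norm x)\<^sup>2 + (norm y)\<^sup>2 - 2 * (x \<bullet> y)"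
    by (simp_all add: power2_norm_eq_inner algebra_simps inner_commute)
  ultimately show inner: "2 * \<bar>x \<bullet> y\<bar> \<le> (norm x)\<^sup>2"
    unfolding N(1) by linarith
  show "\<Lambda> = lat x y"
  proof (intro equalityI subsetI)
    fix z assume "z \<in> lat x y"
    then obtain i j where "z = of_int i *\<^sub>R x + of_int j *\<^sub>R y"
      by (auto simp: lat_def)
    then show "z \<in> \<Lambda>"
      using comb[OF zero_in_full_rank_lattice[OF \<Lambda>], of i j] by simp
  next
    fix z assume "z \<in> \<Lambda>"
    define \<alpha> \<beta> where "\<alpha> = cross z y / cross x y" and "\<beta> = cross x z / cross x y"
    have z: "z = \<alpha> *\<^sub>R x + \<beta> *\<^sub>R y"
      unfolding \<alpha>_def \<beta>_def using assms(4) by (rule cramer_vec2)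
    define p q where "p = \<alpha> - of_int (round \<alpha>)" and "q = \<beta> - of_int (round \<beta>)"
    define w where "w = p *\<^sub>R x + q *\<^sub>R y"
    have w: "w = z + of_int (- round \<alpha>) *\<^sub>R x + of_int (- round \<beta>) *\<^sub>R y"
      by (simp add: w_def p_def q_def z algebra_simps)
    have pq: "\<bar>p\<bar> \<le> 1 / 2" "\<bar>q\<bar> \<le> 1 / 2"
      using of_int_round_abs_le[of \<alpha>] of_int_round_abs_le[of \<beta>] by (auto simp: p_def q_def abs_minus_commute)
    have "p\<^sup>2 \<le> (1 / 2)\<^sup>2" "q\<^sup>2 \<le> (1 / 2)\<^sup>2"
      using pq by (simp_all flip: abs_le_square_iff)
    then have "p\<^sup>2 * (norm x)\<^sup>2 \<le> 1 / 4 * (norm x)\<^sup>2" "q\<^sup>2 * (norm x)\<^sup>2 \<le> 1 / 4 * (norm x)\<^sup>2"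
      by (intro mult_right_mono; simp add: power2_eq_square)+
    moreover have "p * q * (x \<bullet> y) \<le> 1 / 2 * (1 / 2) * ((norm x)\<^sup>2 / 2)"
    proof -
      have "p * q * (x \<bullet> y) \<le> \<bar>p\<bar> * \<bar>q\<bar> * \<bar>x \<bullet> y\<bar>"
        by (simp flip: abs_mult)
      also have "\<dots> \<le> 1 / 2 * (1 / 2) * ((norm x)\<^sup>2 / 2)"
        using pq inner by (intro mult_mono) auto
      finally show ?thesis .
    qed
    moreover have "(norm w)\<^sup>2 = p\<^sup>2 * (norm x)\<^sup>2 + q\<^sup>2 * (norm x)\<^sup>2 + 2 * (p * q * (x \<bullet> y))"
    proof -
      have "(norm w)\<^sup>2 = p\<^sup>2 * (norm x)\<^sup>2 + q\<^sup>2 * (norm y)\<^sup>2 + 2 * (p * q * (x \<bullet> y))"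
        unfolding power2_norm_eq_inner by (simp add: w_def inner_add_left inner_add_right
            inner_commute[of y x] power2_eq_square algebra_simps)
      then show ?thesis by (simp add: N(1))
    qed
    moreover have "0 < (norm x)\<^sup>2" using \<open>x \<noteq> 0\<close> by simp
    ultimately have "(norm w)\<^sup>2 < (norm x)\<^sup>2" by linarith
    moreover have "w \<in> \<Lambda>" unfolding w by (rule comb) fact
    ultimately have "w = 0" using min[of w] by linarith
    then have "z = of_int (round \<alpha>) *\<^sub>R x + of_int (round \<beta>) *\<^sub>R y"
      by (simp add: w_def p_def q_def z algebra_simps)
    then show "z \<in> lat x y" unfolding lat_def by blast
  qed
qed

section \<open>Rhombic description of well-rounded sublattices\<close>

text \<open>
  The diagonals of a rhombus are orthogonal, so a rhombic integer lattice is generated by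
  \<open>(k p + l J p) / 2\<close> and \<open>(k p - l J p) / 2\<close> with \<open>p = (m, n)\<close> and \<open>J p = (- n, m)\<close>.
\<close>

definition rvec :: "int \<Rightarrow> int \<Rightarrow> int \<Rightarrow> int \<Rightarrow> real ^ 2" where
  "rvec k l m n = vector [of_int (k * m - l * n) / 2, of_int (k * n + l * m) / 2]"

definition rhombic :: "int \<Rightarrow> int \<Rightarrow> int \<Rightarrow> int \<Rightarrow> (real ^ 2) set" where
  "rhombic k l m n = lat (rvec k l m n) (rvec k (- l) m n)"

lemma cross_rvec: "2 * cross (rvec k l m n) (rvec k (- l) m n) = - of_int (k * l * (m\<^sup>2 + n\<^sup>2))"
  by (simp add: cross_def rvec_def power2_eq_square field_simps)

text \<open>As a complex number, \<open>rvec k l m n\<close> is the product of the Gaussian integers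
  \<open>k + l i\<close> and \<open>m + n i\<close> divided by 2, and norms are
  multiplicative.\<close>

lemma norm_rvec: "4 * (norm (rvec k l m n))\<^sup>2 = of_int ((k\<^sup>2 + l\<^sup>2) * (m\<^sup>2 + n\<^sup>2))"
proof -
  have "4 * (norm (rvec k l m n))\<^sup>2 = (of_int (k * m - l * n))\<^sup>2 + (of_int (k * n + l * m))\<^sup>2"
    unfolding norm_power2_vec2 rvec_def vector_2 power_divide by simp
  also have "\<dots> = of_int ((k * m - l * n)\<^sup>2 + (k * n + l * m)\<^sup>2)" by simp
  also have "(k * m - l * n)\<^sup>2 + (k * n + l * m)\<^sup>2 = (k\<^sup>2 + l\<^sup>2) * (m\<^sup>2 + n\<^sup>2)"
    by (simp add: power2_eq_square algebra_simps)
  finally show ?thesis .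
qed

text \<open>Every vector of a rhombic lattice is an \<open>rvec\<close> with the same
  \<open>m, n\<close>, so \<open>norm_rvec\<close> evaluates the quadratic form of the
  lattice.\<close>

lemma rvec_combination:
  "of_int i *\<^sub>R rvec k l m n + of_int j *\<^sub>R rvec k (- l) m n = rvec ((i + j) * k) ((i - j) * l) m n"
  unfolding vec_eq_iff forall_2 rvec_def vector_add_component vector_scaleR_component vector_2
  by (simp add: algebra_simps add_divide_distrib diff_divide_distrib)

lemma lattice_det_rhombic:
  assumes "k \<noteq> 0" "l \<noteq> 0" "(m, n) \<noteq> (0, 0)"
  shows "2 * lattice_det (rhombic k l m n) = of_int (\<bar>k * l\<bar> * (m\<^sup>2 + n\<^sup>2))"
    and "cross (rvec k l m n) (rvec k (- l) m n) \<noteq> 0"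
proof -
  have pos: "0 < m\<^sup>2 + n\<^sup>2"
    using assms by (simp add: sum_power2_gt_zero_iff)
  with assms have "k * l * (m\<^sup>2 + n\<^sup>2) \<noteq> 0" by simp
  then have "2 * cross (rvec k l m n) (rvec k (- l) m n) \<noteq> 0"
    by (simp only: cross_rvec neg_equal_0_iff_equal of_int_eq_0_iff not_False_eq_True)
  then show cross: "cross (rvec k l m n) (rvec k (- l) m n) \<noteq> 0" by simp
  have "2 * lattice_det (rhombic k l m n) = \<bar>2 * cross (rvec k l m n) (rvec k (- l) m n)\<bar>"
    unfolding rhombic_def lattice_det_lat[OF cross] by simp
  also have "\<dots> = of_int \<bar>k * l * (m\<^sup>2 + n\<^sup>2)\<bar>"
    unfolding cross_rvec by simp
  finally show "2 * lattice_det (rhombic k l m n) = of_int (\<bar>k * l\<bar> * (m\<^sup>2 + n\<^sup>2))"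
    using pos by (simp add: abs_mult)
qed

text \<open>Dividing \<open>(u1, u2)\<close> by its gcd leaves a primitive vector
  \<open>(m, n)\<close>, and the integer vectors orthogonal to a primitive vector are the integer
  multiples of its quarter turn \<open>(- n, m)\<close>.\<close>

lemma orthogonal_int:
  fixes u1 u2 v1 v2 :: int
  assumes "u1 * v1 + u2 * v2 = 0" "(u1, u2) \<noteq> (0, 0)"
  obtains k l m n where "u1 = k * m" "u2 = k * n" "v1 = - l * n" "v2 = l * m"
proof -
  define g m n where "g = gcd u1 u2" and "m = u1 div g" and "n = u2 div g"
  have g: "g \<noteq> 0" using assms(2) by (simp add: g_def)
  have u: "u1 = g * m" "u2 = g * n" by (simp_all add: g_def m_def n_def)
  have coprime: "coprime m n"
    using assms(2) by (auto simp: g_def m_def n_def intro: div_gcd_coprime)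
  have "g * (m * v1 + n * v2) = 0"
    using assms(1) by (simp add: u algebra_simps)
  with g have 0: "m * v1 + n * v2 = 0" by simp
  have "\<exists>l. v1 = - l * n \<and> v2 = l * m"
  proof (cases "n = 0")
    case True
    with coprime have "\<bar>m\<bar> = 1" by simp
    then have "m * m = 1" by (metis abs_mult_self_eq mult_1)
    moreover from this 0 True have "v1 = 0" by auto
    \<comment> \<open>Here \<open>m\<close> is 1 or -1, so multiplying by \<open>m\<close> is the
      same as dividing by it.\<close>
    ultimately show ?thesis using True by (intro exI[of _ "v2 * m"]) (simp add: mult.assoc)
  next
    case False
    have "n dvd m * v1" using 0 by (metis dvd_triv_left dvd_minus_iff eq_neg_iff_add_eq_0)
    then obtain c where c: "v1 = n * c"
      using coprime by (metis coprime_commute coprime_dvd_mult_right_iff dvdE)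
    with 0 have "n * (m * c + v2) = 0" by (simp add: algebra_simps)
    with False have "m * c + v2 = 0" by simp
    then have "v2 = - c * m" by (simp add: eq_neg_iff_add_eq_0 algebra_simps)
    with c show ?thesis by (intro exI[of _ "- c"]) simp
  qed
  then obtain l where "v1 = - l * n" "v2 = l * m" by blast
  with u show thesis by (rule that)
qed


text \<open>Two minimal vectors form a basis with integer coordinates, so the determinant is a
  nonzero integer up to sign. The successor form matches the indexing of the Dirichlet
  coefficients.\<close>

lemma WR_Z2_det_Suc:
  assumes "\<Lambda> \<in> WR_Z2"
  obtains u where "lattice_det \<Lambda> = real (Suc u)"
proof -
  have full: "full_rank_lattice \<Lambda>" and wr: "well_rounded \<Lambda>" and int: "\<Lambda> \<subseteq> integer_lattice"
    using assms by (auto simp: WR_Z2_def)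
  obtain x y where xy: "x \<in> minimal_vectors \<Lambda>" "y \<in> minimal_vectors \<Lambda>" "cross x y \<noteq> 0"
    using wr by (rule well_rounded_independent)
  have "x \<in> integer_lattice" "y \<in> integer_lattice"
    using xy int by (auto simp: minimal_vectors_def)
  then have "cross x y \<in> \<int>"
    by (auto simp: cross_def integer_lattice_def intro!: Ints_diff Ints_mult)
  then obtain c where "cross x y = of_int c" by (auto elim: Ints_cases)
  moreover have "lattice_det \<Lambda> = \<bar>cross x y\<bar>"
    using minimal_vectors_generate(1)[OF full xy] lattice_det_lat[OF xy(3)] by simp
  ultimately have "lattice_det \<Lambda> = real (Suc (nat \<bar>c\<bar> - 1))"
    using xy(3) by (simp add: Suc_diff_1)
  then show thesis by (rule that)
qed

text \<open>Minimal basis vectors have equal length, so their sum and difference are orthogonal and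
  \<open>orthogonal_int\<close> supplies the parameters. The inequalities between \<open>k\<close>
  and \<open>l\<close> translate the angle bound for a minimal basis.\<close>

lemma WR_Z2_rhombic:
  assumes "\<Lambda> \<in> WR_Z2"
  obtains k l m n where "\<Lambda> = rhombic k l m n" "k \<noteq> 0" "l \<noteq> 0" "(m, n) \<noteq> (0, 0)"
    "k\<^sup>2 \<le> 3 * l\<^sup>2" "l\<^sup>2 \<le> 3 * k\<^sup>2"
proof -
  have full: "full_rank_lattice \<Lambda>" and wr: "well_rounded \<Lambda>" and int: "\<Lambda> \<subseteq> integer_lattice"
    using assms by (auto simp: WR_Z2_def)
  obtain x y where xy: "x \<in> minimal_vectors \<Lambda>" "y \<in> minimal_vectors \<Lambda>" "cross x y \<noteq> 0"
    using wr by (rule well_rounded_independent)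
  have "x \<in> integer_lattice" "y \<in> integer_lattice"
    using xy int by (auto simp: minimal_vectors_def)
  then obtain x1 x2 y1 y2 where coord: "x $ 1 = of_int x1" "x $ 2 = of_int x2"
      "y $ 1 = of_int y1" "y $ 2 = of_int y2"
    by (auto simp: integer_lattice_def forall_2 elim!: Ints_cases)
  have "(norm x)\<^sup>2 = (norm y)\<^sup>2"
    using xy by (simp add: minimal_vectors_def)
  then have "of_int (x1\<^sup>2 + x2\<^sup>2) = (of_int (y1\<^sup>2 + y2\<^sup>2) :: real)"
    by (simp add: norm_power2_vec2 coord)
  then have "x1\<^sup>2 + x2\<^sup>2 = y1\<^sup>2 + y2\<^sup>2" by (simp only: of_int_eq_iff)
  then have "(x1 + y1) * (x1 - y1) + (x2 + y2) * (x2 - y2) = 0"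
    by (simp add: power2_eq_square algebra_simps)
  moreover have "(x1 + y1, x2 + y2) \<noteq> (0, 0)"
    using xy(3) by (auto simp: cross_def coord eq_neg_iff_add_eq_0[symmetric])
  ultimately obtain k l m n where uv: "x1 + y1 = k * m" "x2 + y2 = k * n"
      "x1 - y1 = - l * n" "x2 - y2 = l * m"
    by (rule orthogonal_int)
  have "2 * x1 = k * m - l * n" "2 * x2 = k * n + l * m" "2 * y1 = k * m + l * n" "2 * y2 = k * n - l * m"
    using uv by linarith+
  then have rv: "x = rvec k l m n" "y = rvec k (- l) m n"
    by (simp_all add: vec_eq_iff forall_2 rvec_def coord flip: of_int_mult of_int_add of_int_diff)
  have nz: "k * l * (m\<^sup>2 + n\<^sup>2) \<noteq> 0"
    using xy(3) cross_rvec[of k l m n] unfolding rv by auto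
  then have pos: "0 < m\<^sup>2 + n\<^sup>2"
    by (metis mult_zero_right not_sum_power2_lt_zero linorder_neqE_linordered_idom)
  \<comment> \<open>Polarization expresses the inner product by norms; the diagonal
    \<open>x + y\<close> is \<open>rvec (2 * k) 0 m n\<close>, so all three are known from
    \<open>norm_rvec\<close>.\<close>
  have "8 * (x \<bullet> y) = 4 * ((norm (x + y))\<^sup>2 - (norm x)\<^sup>2 - (norm y)\<^sup>2)"
    by (simp add: power2_norm_eq_inner algebra_simps inner_commute)
  also have "\<dots> = of_int ((4 * k\<^sup>2 - (k\<^sup>2 + l\<^sup>2) - (k\<^sup>2 + l\<^sup>2)) * (m\<^sup>2 + n\<^sup>2))"
    using norm_rvec[of k l m n] norm_rvec[of k "- l" m n] norm_rvec[of "2 * k" 0 m n]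
      rvec_combination[of 1 k l m n 1]
    by (simp add: rv algebra_simps)
  finally have "4 * (x \<bullet> y) = of_int ((k\<^sup>2 - l\<^sup>2) * (m\<^sup>2 + n\<^sup>2))"
    by (simp add: algebra_simps)
  then have "\<bar>of_int ((k\<^sup>2 - l\<^sup>2) * (m\<^sup>2 + n\<^sup>2)) :: real\<bar> * 2 \<le> of_int ((k\<^sup>2 + l\<^sup>2) * (m\<^sup>2 + n\<^sup>2))"
    using minimal_vectors_generate(2)[OF full xy] norm_rvec[of k l m n] unfolding rv
    by linarith
  then have *: "\<bar>(k\<^sup>2 - l\<^sup>2) * (m\<^sup>2 + n\<^sup>2)\<bar> * 2 \<le> (k\<^sup>2 + l\<^sup>2) * (m\<^sup>2 + n\<^sup>2)"
    by linarith
  have conv: "a \<le> 3 * b \<and> b \<le> 3 * a" if "2 * \<bar>a - b\<bar> \<le> a + b" for a b :: int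
    using that by arith
  from * have "(2 * \<bar>k\<^sup>2 - l\<^sup>2\<bar>) * (m\<^sup>2 + n\<^sup>2) \<le> (k\<^sup>2 + l\<^sup>2) * (m\<^sup>2 + n\<^sup>2)"
    using pos by (simp add: abs_mult mult_ac)
  then have "2 * \<bar>k\<^sup>2 - l\<^sup>2\<bar> \<le> k\<^sup>2 + l\<^sup>2"
    using pos by (rule mult_right_le_imp_le)
  then have "k\<^sup>2 \<le> 3 * l\<^sup>2" "l\<^sup>2 \<le> 3 * k\<^sup>2"
    using conv[of "k\<^sup>2" "l\<^sup>2"] by simp_all
  moreover have "\<Lambda> = rhombic k l m n"
    using minimal_vectors_generate(1)[OF full xy] by (simp add: rhombic_def rv)
  ultimately show thesis
    using nz pos by (intro that[of k l m n]) auto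
qed

section \<open>An injective family of well-rounded lattices\<close>

lemma well_roundedI:
  assumes "x \<in> minimal_vectors \<Lambda>" "y \<in> minimal_vectors \<Lambda>" "cross x y \<noteq> 0"
  shows "well_rounded \<Lambda>"
proof -
  have "z \<in> span (minimal_vectors \<Lambda>)" for z
    by (subst cramer_vec2[OF assms(3), of z]) (intro span_add span_scale span_base assms)
  then show ?thesis by (auto simp: well_rounded_def)
qed

text \<open>
  With \<open>a < b \<le> 3 a / 2\<close> the short diagonal of the rhombus is still longer than its sides, so the
  sides are the only minimal vectors.
\<close>

lemma rhombus_form_minimum:
  fixes a b i j :: int
  assumes "0 < a" "a < b" "2 * b \<le> 3 * a" "(i, j) \<noteq> (0, 0)"
  defines "Q \<equiv> (i + j)\<^sup>2 * a\<^sup>2 + (i - j)\<^sup>2 * b\<^sup>2"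
  shows "a\<^sup>2 + b\<^sup>2 \<le> Q"
    and "Q = a\<^sup>2 + b\<^sup>2 \<Longrightarrow> (i, j) \<in> {(1, 0), (- 1, 0), (0, 1), (0, - 1)}"
proof -
  have sq: "1 \<le> t\<^sup>2" if "t \<noteq> 0" for t :: int
    using that by (simp add: int_one_le_iff_zero_less)
  have "(2 * b)\<^sup>2 \<le> (3 * a)\<^sup>2" by (rule power_mono) (use assms in auto)
  moreover have "a\<^sup>2 < b\<^sup>2" by (rule power_strict_mono) (use assms in auto)
  moreover have "0 < a\<^sup>2" using assms by simp
  \<comment> \<open>From \<open>2 * b \<le> 3 * a\<close> follows
    \<open>4 * b\<^sup>2 \<le> 9 * a\<^sup>2\<close>, hence
    \<open>b\<^sup>2 < 3 * a\<^sup>2\<close>.\<close>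
  ultimately have short: "a\<^sup>2 + b\<^sup>2 < 4 * a\<^sup>2" "a\<^sup>2 + b\<^sup>2 < 4 * b\<^sup>2"
    by (simp_all add: power_mult_distrib)
  have "a\<^sup>2 + b\<^sup>2 \<le> Q \<and> (Q = a\<^sup>2 + b\<^sup>2 \<longrightarrow> \<bar>i + j\<bar> = 1 \<and> \<bar>i - j\<bar> = 1)"
  proof (cases "i + j = 0 \<or> i - j = 0")
    case True
    then have "i \<noteq> 0" and "Q = i\<^sup>2 * (4 * b\<^sup>2) \<or> Q = i\<^sup>2 * (4 * a\<^sup>2)"
      using assms(4) by (auto simp: Q_def eq_neg_iff_add_eq_0[symmetric] power_mult_distrib simp flip: mult_2)
    moreover have "1 * (4 * b\<^sup>2) \<le> i\<^sup>2 * (4 * b\<^sup>2)" "1 * (4 * a\<^sup>2) \<le> i\<^sup>2 * (4 * a\<^sup>2)"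
      using sq[OF \<open>i \<noteq> 0\<close>] by (intro mult_right_mono; simp)+
    ultimately have "a\<^sup>2 + b\<^sup>2 < Q" using short by linarith
    then show ?thesis by simp
  next
    case False
    \<comment> \<open>Off the diagonals both squares are at least 1. The excesses \<open>s\<close>
      and \<open>t\<close> are nonnegative, and equality with \<open>a\<^sup>2 + b\<^sup>2\<close>
      forces both to vanish.\<close>
    define s t where "s = (i + j)\<^sup>2 - 1" and "t = (i - j)\<^sup>2 - 1"
    have Q: "Q = a\<^sup>2 + b\<^sup>2 + s * a\<^sup>2 + t * b\<^sup>2"
      by (simp add: Q_def s_def t_def algebra_simps)
    have st: "0 \<le> s" "0 \<le> t" using False sq[of "i + j"] sq[of "i - j"] by (auto simp: s_def t_def)
    then have "0 \<le> s * a\<^sup>2" "0 \<le> t * b\<^sup>2" by auto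
    moreover have "s = 0 \<and> t = 0" if "s * a\<^sup>2 + t * b\<^sup>2 = 0"
      using that st assms by (simp add: add_nonneg_eq_0_iff)
    moreover have "\<bar>i + j\<bar> = 1" if "s = 0" using that by (auto simp: s_def power2_eq_1_iff)
    moreover have "\<bar>i - j\<bar> = 1" if "t = 0" using that by (auto simp: t_def power2_eq_1_iff)
    ultimately show ?thesis using Q by auto
  qed
  then show "a\<^sup>2 + b\<^sup>2 \<le> Q" "Q = a\<^sup>2 + b\<^sup>2 \<Longrightarrow> (i, j) \<in> {(1, 0), (- 1, 0), (0, 1), (0, - 1)}"
    by (auto simp: abs_if split: if_splits)
qed

text \<open>Even parameters clear the denominators, so the lattice is integral whatever the parities
  of \<open>m\<close> and \<open>n\<close>.\<close>

lemma rvec_even: "rvec (2 * a) (2 * b) m n = vector [of_int (a * m - b * n), of_int (a * n + b * m)]"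
  by (simp add: rvec_def vec_eq_iff forall_2 field_simps)

text \<open>By \<open>rvec_combination\<close> and \<open>norm_rvec\<close> the squared norm is
  \<open>m\<^sup>2 + n\<^sup>2\<close> times the form of \<open>rhombus_form_minimum\<close>. The
  complete list of minimal vectors is what lets a lattice be traced back to its parameters.\<close>

lemma minimal_vectors_rhombic_even:
  assumes ab: "0 < a" "a < b" "2 * b \<le> 3 * a" and mn: "0 < m" "0 < n"
  defines "x \<equiv> rvec (2 * a) (2 * b) m n" and "y \<equiv> rvec (2 * a) (2 * - b) m n"
  shows "minimal_vectors (rhombic (2 * a) (2 * b) m n) = {x, - x, y, - y}"
proof -
  let ?\<Lambda> = "rhombic (2 * a) (2 * b) m n" and ?P = "m\<^sup>2 + n\<^sup>2"
  have \<Lambda>: "?\<Lambda> = lat x y" by (simp add: rhombic_def x_def y_def)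
  have P: "0 < ?P" using mn by (simp add: sum_power2_gt_zero_iff)
  have norm: "(norm (of_int i *\<^sub>R x + of_int j *\<^sub>R y))\<^sup>2 =
      of_int (((i + j)\<^sup>2 * a\<^sup>2 + (i - j)\<^sup>2 * b\<^sup>2) * ?P)" for i j
  proof -
    have "4 * (norm (of_int i *\<^sub>R x + of_int j *\<^sub>R y))\<^sup>2 =
        of_int ((((i + j) * (2 * a))\<^sup>2 + ((i - j) * (2 * b))\<^sup>2) * ?P)"
      unfolding x_def y_def mult_minus_right rvec_combination norm_rvec ..
    also have "(((i + j) * (2 * a))\<^sup>2 + ((i - j) * (2 * b))\<^sup>2) * ?P =
        4 * (((i + j)\<^sup>2 * a\<^sup>2 + (i - j)\<^sup>2 * b\<^sup>2) * ?P)"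
      unfolding power_mult_distrib by (simp add: algebra_simps)
    finally show ?thesis by simp
  qed
  have norm_x: "(norm x)\<^sup>2 = of_int ((a\<^sup>2 + b\<^sup>2) * ?P)"
    using norm[of 1 0] by simp
  have cross: "cross x y \<noteq> 0"
    using lattice_det_rhombic(2)[of "2 * a" "2 * b" m n] ab mn by (simp add: x_def y_def)
  then have "x \<noteq> 0" by (auto simp: cross_def)
  have mem: "of_int i *\<^sub>R x + of_int j *\<^sub>R y \<in> ?\<Lambda>" for i j
    unfolding \<Lambda> lat_def by blast
  have x: "x \<in> ?\<Lambda>" using mem[of 1 0] by simp
  have min: "norm x \<le> norm z" and min_eq: "norm z = norm x \<Longrightarrow> z \<in> {x, - x, y, - y}"
    if z: "z \<in> ?\<Lambda>" "z \<noteq> 0" for z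
  proof -
    obtain i j where ij: "z = of_int i *\<^sub>R x + of_int j *\<^sub>R y"
      using z(1) unfolding \<Lambda> lat_def by blast
    with z(2) have ne: "(i, j) \<noteq> (0, 0)" by auto
    note Q = rhombus_form_minimum[OF ab ne]
    have "(norm x)\<^sup>2 \<le> (norm z)\<^sup>2"
      unfolding norm_x ij norm of_int_le_iff using Q(1) P by (intro mult_right_mono) auto
    then show "norm x \<le> norm z" by (rule power2_le_imp_le) simp
    assume "norm z = norm x"
    then have "(norm z)\<^sup>2 = (norm x)\<^sup>2" by simp
    then have "(i + j)\<^sup>2 * a\<^sup>2 + (i - j)\<^sup>2 * b\<^sup>2 = a\<^sup>2 + b\<^sup>2"
      unfolding norm_x ij norm of_int_eq_iff using P by (simp only: mult_cancel_right) auto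
    then have "(i, j) \<in> {(1, 0), (- 1, 0), (0, 1), (0, - 1)}" by (rule Q(2))
    then show "z \<in> {x, - x, y, - y}" by (auto simp: ij)
  qed
  have lmin: "lattice_min ?\<Lambda> = norm x"
    unfolding lattice_min_def using x \<open>x \<noteq> 0\<close> min by (intro cInf_eq_minimum) auto
  have norm_y: "norm y = norm x"
    using norm[of 0 1] norm_x by (metis add_0 diff_0 norm_ge_zero of_int_0 of_int_1
        power2_eq_imp_eq power2_minus scaleR_one scaleR_zero_left mult_1 power_one)
  have neg: "- x \<in> ?\<Lambda>" "y \<in> ?\<Lambda>" "- y \<in> ?\<Lambda>"
    using mem[of "- 1" 0] mem[of 0 1] mem[of 0 "- 1"] by simp_all
  have "z \<noteq> 0" if "norm z = norm x" for z :: "real ^ 2"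
    using that \<open>x \<noteq> 0\<close> by auto
  then show ?thesis
    using min_eq x neg norm_y by (auto simp: minimal_vectors_def lmin)
qed

lemma rhombic_even_WR_Z2:
  assumes ab: "0 < a" "a < b" "2 * b \<le> 3 * a" and mn: "0 < m" "0 < n"
  shows "rhombic (2 * a) (2 * b) m n \<in> WR_Z2"
    and "lattice_det (rhombic (2 * a) (2 * b) m n) = of_int (2 * a * b * (m\<^sup>2 + n\<^sup>2))"
proof -
  define x y where "x = rvec (2 * a) (2 * b) m n" and "y = rvec (2 * a) (2 * - b) m n"
  have \<Lambda>: "rhombic (2 * a) (2 * b) m n = lat x y" by (simp add: rhombic_def x_def y_def)
  have cross: "cross x y \<noteq> 0"
    using lattice_det_rhombic(2)[of "2 * a" "2 * b" m n] ab mn by (simp add: x_def y_def)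
  have "x \<in> minimal_vectors (lat x y)" "y \<in> minimal_vectors (lat x y)"
    using minimal_vectors_rhombic_even[OF ab mn] unfolding \<Lambda> x_def y_def by simp_all
  then have "well_rounded (lat x y)" using cross by (rule well_roundedI)
  moreover have "lat x y \<subseteq> integer_lattice"
    unfolding x_def y_def rvec_even lat_def integer_lattice_def
    by (auto simp: forall_2)
  ultimately show "rhombic (2 * a) (2 * b) m n \<in> WR_Z2"
    using full_rank_lattice_lat[OF cross] by (simp add: WR_Z2_def \<Lambda>)
  show "lattice_det (rhombic (2 * a) (2 * b) m n) = of_int (2 * a * b * (m\<^sup>2 + n\<^sup>2))"
    using lattice_det_rhombic(1)[of "2 * a" "2 * b" m n] ab mn by (simp add: abs_mult)
qed

text \<open>Equal lattices have the same four minimal vectors, hence the same diagonals once signs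
  and order are settled. The gcd of the coordinates of a diagonal is then \<open>a\<close>, because
  \<open>m\<close> and \<open>n\<close> are coprime.\<close>

lemma rhombic_even_inject:
  assumes ab: "0 < a" "a < b" "2 * b \<le> 3 * a" and mn: "0 < m" "0 < n" "coprime m n"
    and ab': "0 < a'" "a' < b'" "2 * b' \<le> 3 * a'" and mn': "0 < m'" "0 < n'" "coprime m' n'"
    and eq: "rhombic (2 * a) (2 * b) m n = rhombic (2 * a') (2 * b') m' n'"
  shows "a = a' \<and> b = b' \<and> m = m' \<and> n = n'"
proof -
  have vec: "vector [of_int p, of_int q] = (vector [of_int r, of_int s] :: real ^ 2) \<longleftrightarrow> p = r \<and> q = s"
    and neg: "- (vector [of_int p, of_int q] :: real ^ 2) = vector [of_int (- p), of_int (- q)]"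
    for p q r s :: int
    by (auto simp: vec_eq_iff forall_2)
  have pos: "0 < a * m" "0 < a * n" "0 < b * m" "0 < b * n"
     "0 < a' * m'" "0 < a' * n'" "0 < b' * m'" "0 < b' * n'"
    using ab mn ab' mn' by auto
  define x y where "x = rvec (2 * a) (2 * b) m n" and "y = rvec (2 * a) (2 * - b) m n"
  define x' y' where "x' = rvec (2 * a') (2 * b') m' n'" and "y' = rvec (2 * a') (2 * - b') m' n'"
  have "{x, - x, y, - y} = {x', - x', y', - y'}"
    using minimal_vectors_rhombic_even[OF ab mn(1,2)] minimal_vectors_rhombic_even[OF ab' mn'(1,2)] eq
    by (simp add: x_def y_def x'_def y'_def)
  then have "x' \<in> {x, - x, y, - y}" "y' \<in> {x, - x, y, - y}" by auto
  \<comment> \<open>Of the sixteen placements of \<open>x'\<close> and \<open>y'\<close> among the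
    four vectors, only \<open>x' = x\<close> and \<open>y' = y\<close> keeps all products positive;
    this is where \<open>(m, n)\<close> in the open first quadrant excludes quarter turns.\<close>
  then have "a' * m' = a * m \<and> a' * n' = a * n \<and> b' * m' = b * m \<and> b' * n' = b * n"
    unfolding x_def y_def x'_def y'_def rvec_even neg insert_iff empty_iff vec
    using pos by (elim disjE conjE FalseE) linarith+
  moreover from this have "gcd (a' * m') (a' * n') = gcd (a * m) (a * n)" by simp
  then have "a' = a"
    using ab ab' mn mn' by (simp add: gcd_mult_left)
  ultimately show ?thesis using ab ab' mn mn' by auto
qed

section \<open>The zeta function of well-rounded sublattices\<close>

text \<open>Choosing parameters for each lattice is injective, as they determine the lattice. The
  ratio bounds give \<open>k\<^sup>2 + l\<^sup>2 \<le> 4 * \<bar>k * l\<bar>\<close>, so each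
  determinant is at least the product of two sums of squares divided by 8.\<close>

lemma sum_det_WR_Z2_le:
  fixes \<sigma> :: real
  assumes F: "finite F" "F \<subseteq> WR_Z2" and \<sigma>: "1 < \<sigma>"
  shows "(\<Sum>\<Lambda>\<in>F. lattice_det \<Lambda> powr (- \<sigma>)) \<le> 8 powr \<sigma> * (16 / (1 - 4 powr (1 - \<sigma>)))\<^sup>2"
proof -
  define P where "P \<Lambda> v \<longleftrightarrow> (case v of ((k, l), (m, n)) \<Rightarrow> \<Lambda> = rhombic k l m n \<and> k \<noteq> 0 \<and> l \<noteq> 0 \<and>
      (m, n) \<noteq> (0, 0) \<and> k\<^sup>2 \<le> 3 * l\<^sup>2 \<and> l\<^sup>2 \<le> 3 * k\<^sup>2)" for \<Lambda> v
  have "\<exists>v. P \<Lambda> v" if "\<Lambda> \<in> WR_Z2" for \<Lambda>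
    using that by (rule WR_Z2_rhombic) (auto simp: P_def)
  then obtain f where f: "P \<Lambda> (f \<Lambda>)" if "\<Lambda> \<in> WR_Z2" for \<Lambda> by metis
  define g where "g = (\<lambda>(a, b). real_of_int (a\<^sup>2 + b\<^sup>2) powr (- \<sigma>))"
  define V W where "V = fst ` f ` F" and "W = snd ` f ` F"
  have "inj_on f F"
  proof (rule inj_onI)
    fix \<Lambda> M assume "\<Lambda> \<in> F" "M \<in> F" "f \<Lambda> = f M"
    with f[of \<Lambda>] f[of M] F have "P \<Lambda> (f M)" "P M (f M)" by auto
    then show "\<Lambda> = M" unfolding P_def by (auto simp only: split: prod.splits)
  qed
  have fin: "finite V" "finite W" using F by (simp_all add: V_def W_def)
  have V: "(0, 0) \<notin> V" and W: "(0, 0) \<notin> W"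
  proof -
    have "fst (f \<Lambda>) \<noteq> (0, 0) \<and> snd (f \<Lambda>) \<noteq> (0, 0)" if "\<Lambda> \<in> F" for \<Lambda>
    proof -
      obtain k l m n where "f \<Lambda> = ((k, l), (m, n))" by (metis surj_pair)
      with f[of \<Lambda>] that F show ?thesis by (auto simp: P_def)
    qed
    then show "(0, 0) \<notin> V" "(0, 0) \<notin> W" by (force simp: V_def W_def)+
  qed
  have det: "lattice_det \<Lambda> powr (- \<sigma>) \<le> 8 powr \<sigma> * (g (fst (f \<Lambda>)) * g (snd (f \<Lambda>)))" if "\<Lambda> \<in> F" for \<Lambda>
  proof -
    obtain k l m n where eq: "f \<Lambda> = ((k, l), (m, n))" by (metis surj_pair)
    have \<Lambda>: "\<Lambda> = rhombic k l m n" and nz: "k \<noteq> 0" "l \<noteq> 0" "(m, n) \<noteq> (0, 0)"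
      and kl: "k\<^sup>2 \<le> 3 * l\<^sup>2" "l\<^sup>2 \<le> 3 * k\<^sup>2"
      using f[of \<Lambda>] that F by (auto simp: P_def eq)
    have pos: "0 < m\<^sup>2 + n\<^sup>2" "0 < k\<^sup>2 + l\<^sup>2"
      using nz by (simp_all add: sum_power2_gt_zero_iff)
    \<comment> \<open>The ratio bounds yield the constant \<open>3 + 3 + 2 = 8\<close>; it is
      enlarged to 16, a perfect square, so that a root can be taken.\<close>
    have "(k\<^sup>2 + l\<^sup>2)\<^sup>2 \<le> (4 * \<bar>k * l\<bar>)\<^sup>2"
    proof -
      have "k\<^sup>2 * k\<^sup>2 \<le> 3 * (k\<^sup>2 * l\<^sup>2)" "l\<^sup>2 * l\<^sup>2 \<le> 3 * (k\<^sup>2 * l\<^sup>2)"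
        using mult_right_mono[OF kl(1), of "k\<^sup>2"] mult_right_mono[OF kl(2), of "l\<^sup>2"]
        by (simp_all add: mult_ac)
      moreover have "0 \<le> k\<^sup>2 * l\<^sup>2" by simp
      ultimately have "k\<^sup>2 * k\<^sup>2 + l\<^sup>2 * l\<^sup>2 + 2 * (k\<^sup>2 * l\<^sup>2) \<le> 16 * (k\<^sup>2 * l\<^sup>2)"
        by linarith
      then show ?thesis
        by (simp add: power_mult_distrib power2_sum)
    qed
    then have "k\<^sup>2 + l\<^sup>2 \<le> 4 * \<bar>k * l\<bar>" by (rule power2_le_imp_le) simp
    then have "(k\<^sup>2 + l\<^sup>2) * (m\<^sup>2 + n\<^sup>2) \<le> 4 * \<bar>k * l\<bar> * (m\<^sup>2 + n\<^sup>2)"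
      using pos by (intro mult_right_mono) auto
    then have "real_of_int ((k\<^sup>2 + l\<^sup>2) * (m\<^sup>2 + n\<^sup>2)) \<le> real_of_int (4 * (\<bar>k * l\<bar> * (m\<^sup>2 + n\<^sup>2)))"
      unfolding of_int_le_iff by (simp add: mult.assoc)
    also have "\<dots> = 8 * lattice_det \<Lambda>"
      using lattice_det_rhombic(1)[OF nz] \<Lambda> by (simp add: mult.assoc)
    finally have le: "real_of_int (k\<^sup>2 + l\<^sup>2) * real_of_int (m\<^sup>2 + n\<^sup>2) / 8 \<le> lattice_det \<Lambda>"
      by simp
    have pos': "0 < real_of_int (k\<^sup>2 + l\<^sup>2)" "0 < real_of_int (m\<^sup>2 + n\<^sup>2)"
      using pos by (simp_all only: of_int_0_less_iff)
    have "lattice_det \<Lambda> powr (- \<sigma>) \<le> (real_of_int (k\<^sup>2 + l\<^sup>2) * real_of_int (m\<^sup>2 + n\<^sup>2) / 8) powr (- \<sigma>)"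
      using le pos' \<sigma> by (intro powr_mono2') (auto simp del: of_int_add)
    also have "\<dots> = 8 powr \<sigma> * (real_of_int (k\<^sup>2 + l\<^sup>2) powr (- \<sigma>) * real_of_int (m\<^sup>2 + n\<^sup>2) powr (- \<sigma>))"
      using pos' by (simp add: powr_divide powr_mult powr_minus_divide del: of_int_add)
    finally show ?thesis by (simp add: eq g_def)
  qed
  have g: "0 \<le> g v" for v by (simp add: g_def split_def)
  have "(\<Sum>\<Lambda>\<in>F. lattice_det \<Lambda> powr (- \<sigma>)) \<le> (\<Sum>\<Lambda>\<in>F. 8 powr \<sigma> * (g (fst (f \<Lambda>)) * g (snd (f \<Lambda>))))"
    using det by (rule sum_mono)
  also have "\<dots> = 8 powr \<sigma> * (\<Sum>v\<in>f ` F. g (fst v) * g (snd v))"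
    using \<open>inj_on f F\<close> by (simp add: sum.reindex sum_distrib_left)
  \<comment> \<open>Enlarging the index set to the product of its two projections makes the sum
    factor.\<close>
  also have "\<dots> \<le> 8 powr \<sigma> * (\<Sum>v\<in>V \<times> W. g (fst v) * g (snd v))"
  proof (intro mult_left_mono sum_mono2)
    show "f ` F \<subseteq> V \<times> W"
    proof
      fix v assume "v \<in> f ` F"
      then have "fst v \<in> V" "snd v \<in> W" unfolding V_def W_def by (rule imageI)+
      then show "v \<in> V \<times> W" by (simp add: mem_Times_iff)
    qed
  qed (use fin g in auto)
  also have "\<dots> = 8 powr \<sigma> * (sum g V * sum g W)"
    by (simp add: sum_product sum.cartesian_product split_def)
  also have "\<dots> \<le> 8 powr \<sigma> * (16 / (1 - 4 powr (1 - \<sigma>)) * (16 / (1 - 4 powr (1 - \<sigma>))))"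
  proof -
    have "sum g V \<le> 16 / (1 - 4 powr (1 - \<sigma>))" "sum g W \<le> 16 / (1 - 4 powr (1 - \<sigma>))"
      unfolding g_def by (rule sum_int_square_powr_le[OF fin(1) V \<sigma>] sum_int_square_powr_le[OF fin(2) W \<sigma>])+
    moreover from sum_nonneg[OF g] this(1) have "0 \<le> 16 / (1 - 4 powr (1 - \<sigma>))"
      by (rule order_trans)
    ultimately show ?thesis
      using g by (intro mult_left_mono mult_mono sum_nonneg) auto
  qed
  finally show ?thesis by (simp add: power2_eq_square)
qed

lemma det_powr_summable_on_WR_Z2:
  fixes \<sigma> :: real
  assumes "1 < \<sigma>"
  shows "(\<lambda>\<Lambda>. lattice_det \<Lambda> powr (- \<sigma>)) summable_on WR_Z2"
  using sum_det_WR_Z2_le[OF _ _ assms]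
  by (intro nonneg_bdd_above_summable_on bdd_aboveI2[where M = "8 powr \<sigma> * (16 / (1 - 4 powr (1 - \<sigma>)))\<^sup>2"]) auto

text \<open>
  Dividing by the gcd writes every pair as a multiple of a coprime pair, at the cost of a factor
  \<open>\<Sum>g. 1 / g\<^sup>2 \<le> 2\<close>.
\<close>

lemma sum_coprime_pairs_ge:
  fixes \<sigma> :: real
  assumes "1 \<le> \<sigma>"
  defines "N \<equiv> \<lambda>(m::int, n::int). real_of_int (m\<^sup>2 + n\<^sup>2) powr (- \<sigma>)"
  shows "sum N ({0<..M} \<times> {0<..M}) \<le> 2 * sum N {(m, n). m \<in> {0<..M} \<and> n \<in> {0<..M} \<and> coprime m n}"
    (is "sum N ?A \<le> 2 * sum N ?Y")
proof -
  have fin: "finite ?Y" by (rule finite_subset[of _ ?A]) auto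
  define e where "e = (\<lambda>(m::int, n::int). (nat (gcd m n), (m div gcd m n, n div gcd m n)))"
  define h where "h = (\<lambda>(g::nat, v). 1 / (real g)\<^sup>2 * N v)"
  have inj: "inj_on e ?A"
  proof (rule inj_onI)
    fix v w assume "e v = e w"
    moreover obtain m n m' n' where eq: "v = (m, n)" "w = (m', n')" by (metis surj_pair)
    ultimately have "gcd m n = gcd m' n'" "m div gcd m n = m' div gcd m' n'" "n div gcd m n = n' div gcd m' n'"
      by (auto simp: e_def eq_nat_nat_iff)
    then show "v = w"
      unfolding eq by (metis dvd_mult_div_cancel gcd_dvd1 gcd_dvd2)
  qed
  have e: "e v \<in> {1..nat M} \<times> ?Y \<and> N v \<le> h (e v)" if v: "v \<in> ?A" for v
  proof -
    obtain m n where v_eq: "v = (m, n)" by fastforce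
    with v have mn: "0 < m" "m \<le> M" "0 < n" "n \<le> M" by auto
    define g p q where "g = gcd m n" and "p = m div g" and "q = n div g"
    have m: "m = g * p" and n: "n = g * q" by (simp_all add: g_def p_def q_def)
    have g: "0 < g" "g \<le> m" using mn by (auto simp: g_def intro: zdvd_imp_le)
    have pq: "0 < p" "0 < q" using mn g unfolding m n by (simp_all add: zero_less_mult_iff)
    have "p \<le> m" "q \<le> n" using g pq unfolding m n by (simp_all add: mult_le_cancel_right1)
    have "coprime p q"
      using mn unfolding p_def q_def g_def by (intro div_gcd_coprime) auto
    have "e v = (nat g, (p, q))" by (simp add: e_def v_eq g_def p_def q_def)
    moreover have "nat g \<in> {1..nat M}" using g mn by auto
    moreover have "N v \<le> 1 / (real (nat g))\<^sup>2 * N (p, q)"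
    proof -
      have gr: "1 \<le> real_of_int g" using g by simp
      have pos: "0 < real_of_int (p\<^sup>2 + q\<^sup>2)"
        using pq by (simp only: of_int_0_less_iff sum_power2_gt_zero_iff) auto
      have "real_of_int (m\<^sup>2 + n\<^sup>2) = (real_of_int g)\<^sup>2 * real_of_int (p\<^sup>2 + q\<^sup>2)"
        by (simp add: m n power_mult_distrib distrib_left)
      then have "N v = ((real_of_int g)\<^sup>2) powr (- \<sigma>) * N (p, q)"
        using gr pos by (simp add: N_def v_eq powr_mult del: of_int_add)
      \<comment> \<open>As \<open>g \<ge> 1\<close> and \<open>\<sigma> \<ge> 1\<close>, the
        exponent can be replaced by one independent of \<open>\<sigma>\<close>.\<close>
      also have "\<dots> \<le> ((real_of_int g)\<^sup>2) powr (- 1) * N (p, q)"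
        using gr assms by (intro mult_right_mono powr_mono) (auto simp: N_def)
      also have "((real_of_int g)\<^sup>2) powr (- 1) = 1 / (real (nat g))\<^sup>2"
        using g by (simp add: powr_minus_divide)
      finally show ?thesis .
    qed
    ultimately show ?thesis
      using pq mn \<open>p \<le> m\<close> \<open>q \<le> n\<close> \<open>coprime p q\<close> by (auto simp: h_def)
  qed
  have N: "0 \<le> N v" for v by (simp add: N_def split_def)
  have "sum N ?A \<le> (\<Sum>v\<in>?A. h (e v))" using e by (intro sum_mono) auto
  also have "\<dots> = sum h (e ` ?A)" using inj by (simp add: sum.reindex)
  also have "\<dots> \<le> sum h ({1..nat M} \<times> ?Y)"
  proof (rule sum_mono2)
    show "e ` ?A \<subseteq> {1..nat M} \<times> ?Y" using e by blast
  qed (use fin N in \<open>auto simp: h_def\<close>)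
  also have "\<dots> = (\<Sum>g = 1..nat M. 1 / (real g)\<^sup>2) * sum N ?Y"
    by (simp add: h_def sum_product sum.cartesian_product split_def)
  also have "\<dots> \<le> 2 * sum N ?Y"
    using sum_inverse_squares_le N by (intro mult_right_mono sum_nonneg) auto
  finally show ?thesis .
qed

text \<open>The even rhombic lattices are pairwise distinct members of \<open>WR_Z2\<close>, and
  their determinant \<open>2 * a * b * (m\<^sup>2 + n\<^sup>2)\<close> splits into a factor from
  \<open>X\<close> and one from \<open>Y\<close>.\<close>

lemma infsum_det_WR_Z2_ge_product:
  fixes \<sigma> :: real and X Y :: "(int \<times> int) set"
  assumes \<sigma>: "1 < \<sigma>" and fin: "finite X" "finite Y"
    and X: "\<And>a b. (a, b) \<in> X \<Longrightarrow> 0 < a \<and> a < b \<and> 2 * b \<le> 3 * a"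
    and Y: "\<And>m n. (m, n) \<in> Y \<Longrightarrow> 0 < m \<and> 0 < n \<and> coprime m n"
  shows "(\<Sum>(a, b)\<in>X. real_of_int (2 * a * b) powr (- \<sigma>)) * (\<Sum>(m, n)\<in>Y. real_of_int (m\<^sup>2 + n\<^sup>2) powr (- \<sigma>))
    \<le> (\<Sum>\<^sub>\<infinity>\<Lambda>\<in>WR_Z2. lattice_det \<Lambda> powr (- \<sigma>))"
proof -
  define r where "r = (\<lambda>((a, b), (m, n)). rhombic (2 * a) (2 * b) m n)"
  have inj: "inj_on r (X \<times> Y)"
  proof (rule inj_onI)
    fix v w assume vw: "v \<in> X \<times> Y" "w \<in> X \<times> Y" "r v = r w"
    obtain a b m n a' b' m' n' where eq: "v = ((a, b), (m, n))" "w = ((a', b'), (m', n'))"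
      by (metis surj_pair)
    have "rhombic (2 * a) (2 * b) m n = rhombic (2 * a') (2 * b') m' n'"
      using vw by (simp add: r_def eq)
    then show "v = w"
      using vw X[of a b] X[of a' b'] Y[of m n] Y[of m' n'] rhombic_even_inject[of a b m n a' b' m' n']
      by (auto simp: eq)
  qed
  have WR: "r ` (X \<times> Y) \<subseteq> WR_Z2"
    using X Y by (auto simp: r_def intro!: rhombic_even_WR_Z2)
  have "(\<Sum>(a, b)\<in>X. real_of_int (2 * a * b) powr (- \<sigma>)) * (\<Sum>(m, n)\<in>Y. real_of_int (m\<^sup>2 + n\<^sup>2) powr (- \<sigma>))
      = (\<Sum>((a, b), (m, n))\<in>X \<times> Y. real_of_int (2 * a * b) powr (- \<sigma>) * real_of_int (m\<^sup>2 + n\<^sup>2) powr (- \<sigma>))"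
    by (simp add: sum_product sum.cartesian_product split_def)
  also have "\<dots> = (\<Sum>v\<in>X \<times> Y. lattice_det (r v) powr (- \<sigma>))"
  proof (rule sum.cong[OF refl])
    fix v assume v: "v \<in> X \<times> Y"
    obtain a b m n where eq: "v = ((a, b), (m, n))" by (metis surj_pair)
    have "real_of_int (2 * a * b * (m\<^sup>2 + n\<^sup>2)) powr (- \<sigma>) =
        real_of_int (2 * a * b) powr (- \<sigma>) * real_of_int (m\<^sup>2 + n\<^sup>2) powr (- \<sigma>)"
      using v X[of a b] Y[of m n] unfolding of_int_mult[of _ "m\<^sup>2 + n\<^sup>2"]
      by (subst powr_mult) (auto simp: eq)
    then show "(\<lambda>((a, b), (m, n)). real_of_int (2 * a * b) powr (- \<sigma>) * real_of_int (m\<^sup>2 + n\<^sup>2) powr (- \<sigma>)) v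
        = lattice_det (r v) powr (- \<sigma>)"
      using v X[of a b] Y[of m n] by (simp add: eq r_def rhombic_even_WR_Z2(2))
  qed
  also have "\<dots> = (\<Sum>\<Lambda>\<in>r ` (X \<times> Y). lattice_det \<Lambda> powr (- \<sigma>))"
    using inj by (simp add: sum.reindex)
  also have "\<dots> \<le> (\<Sum>\<^sub>\<infinity>\<Lambda>\<in>WR_Z2. lattice_det \<Lambda> powr (- \<sigma>))"
    using fin WR by (intro finite_sum_le_infsum det_powr_summable_on_WR_Z2 \<sigma>) auto
  finally show ?thesis .
qed

text \<open>Each of the two factors dominates a truncated geometric series, and the truncation level
  \<open>J\<close> then tends to infinity. The factor \<open>1 / 2\<close> is the price of
  restricting to coprime pairs.\<close>

lemma infsum_det_WR_Z2_ge:
  fixes \<sigma> :: real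
  assumes \<sigma>: "1 < \<sigma>"
  shows "1 / 2 * 512 powr (- \<sigma>) * (1 / (1 - 4 powr (1 - \<sigma>)))\<^sup>2 \<le>
    (\<Sum>\<^sub>\<infinity>\<Lambda>\<in>WR_Z2. lattice_det \<Lambda> powr (- \<sigma>))" (is "_ \<le> ?Z")
proof -
  let ?q = "4 powr (1 - \<sigma>)"
  have q: "0 \<le> ?q" "?q < 1"
    using \<sigma> powr_less_mono[of "1 - \<sigma>" 0 4] by auto
  have "1 / 2 * 512 powr (- \<sigma>) * (\<Sum>j<J. ?q ^ j)\<^sup>2 \<le> ?Z" for J
  proof -
    \<comment> \<open>Large enough to contain all scaled squares of levels below \<open>J\<close>,
      whose coordinates stay below \<open>6 * 2 ^ j\<close>.\<close>
    define M where "M = (8 * 2 ^ J :: int)"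
    define X where "X = {(a, b). a \<in> {0<..M} \<and> b \<in> {0<..M} \<and> a < b \<and> 2 * b \<le> 3 * a}"
    define Y where "Y = {(m, n). m \<in> {0<..M} \<and> n \<in> {0<..M} \<and> coprime m n}"
    have fin: "finite X" "finite Y"
      by (rule finite_subset[of _ "{0<..M} \<times> {0<..M}"]; auto simp: X_def Y_def)+
    have two: "1 \<le> (2::int) ^ j" "(2::int) ^ j * 2 ^ j = 4 ^ j" for j :: nat
      by (simp_all flip: power_mult_distrib)
    have M: "(2::int) ^ j * 8 \<le> M" if "j < J" for j
      unfolding M_def using that by (simp add: power_increasing)
    \<comment> \<open>The square with corner \<open>(4, 5)\<close> fits the cone of admissible
      ratios: there \<open>a < 5 * 2 ^ j \<le> b\<close> and
      \<open>2 * b < 12 * 2 ^ j \<le> 3 * a\<close>.\<close>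
    have X: "(a, b) \<in> X"
      if "4 * 2 ^ j \<le> a" "a < (4 + 1) * 2 ^ j" "5 * 2 ^ j \<le> b" "b < (5 + 1) * 2 ^ j" "j < J"
      for a b :: int and j
      using that two(1)[of j] M[of j] by (auto simp: X_def)
    have hX: "0 < real_of_int (2 * a * b) \<and> real_of_int (2 * a * b) \<le> 64 * 4 ^ j"
      if box: "4 * 2 ^ j \<le> a" "a < (4 + 1) * 2 ^ j" "5 * 2 ^ j \<le> b" "b < (5 + 1) * 2 ^ j"
      for a b :: int and j
    proof -
      have "0 < a" "0 < b" using box two(1)[of j] by linarith+
      have "a * b \<le> (5 * 2 ^ j) * (6 * 2 ^ j)"
        using box \<open>0 < a\<close> \<open>0 < b\<close> by (intro mult_mono) auto
      also have "\<dots> = 30 * (4 ^ j :: int)" using two(2)[of j] by simp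
      also have "\<dots> \<le> 32 * 4 ^ j" by (rule mult_right_mono) auto
      finally have "2 * a * b \<le> 64 * 4 ^ j" by simp
      then have "real_of_int (2 * a * b) \<le> real_of_int (64 * 4 ^ j)" by (simp only: of_int_le_iff)
      then show ?thesis
        using \<open>0 < a\<close> \<open>0 < b\<close> by simp
    qed
    have "64 powr (- \<sigma>) * (\<Sum>j<J. ?q ^ j) \<le> (\<Sum>(a, b)\<in>X. real_of_int (2 * a * b) powr (- \<sigma>))"
      by (rule sum_dyadic_square_ge[OF _ _ _ X hX]) (use fin \<sigma> in auto)
    moreover
    have Y: "(m, n) \<in> {0<..M} \<times> {0<..M}"
      if "1 * 2 ^ j \<le> m" "m < (1 + 1) * 2 ^ j" "1 * 2 ^ j \<le> n" "n < (1 + 1) * 2 ^ j" "j < J"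
      for m n :: int and j
      using that two(1)[of j] M[of j] by auto
    have hY: "0 < real_of_int (m\<^sup>2 + n\<^sup>2) \<and> real_of_int (m\<^sup>2 + n\<^sup>2) \<le> 8 * 4 ^ j"
      if box: "1 * 2 ^ j \<le> m" "m < (1 + 1) * 2 ^ j" "1 * 2 ^ j \<le> n" "n < (1 + 1) * 2 ^ j"
      for m n :: int and j
    proof -
      have "0 < m" "0 < n" using box two(1)[of j] by linarith+
      have "m * m \<le> (2 * 2 ^ j) * (2 * 2 ^ j)" "n * n \<le> (2 * 2 ^ j) * (2 * 2 ^ j)"
        using box \<open>0 < m\<close> \<open>0 < n\<close> by (intro mult_mono; simp)+
      moreover have "(2 * 2 ^ j) * (2 * 2 ^ j) = 4 * (4 ^ j :: int)" using two(2)[of j] by simp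
      ultimately have "m\<^sup>2 + n\<^sup>2 \<le> 8 * 4 ^ j" unfolding power2_eq_square by linarith
      then have "real_of_int (m\<^sup>2 + n\<^sup>2) \<le> real_of_int (8 * 4 ^ j)" by (simp only: of_int_le_iff)
      then show ?thesis
        using \<open>0 < m\<close> by (simp add: add_pos_nonneg)
    qed
    have "8 powr (- \<sigma>) * (\<Sum>j<J. ?q ^ j) \<le>
        (\<Sum>(m, n)\<in>{0<..M} \<times> {0<..M}. real_of_int (m\<^sup>2 + n\<^sup>2) powr (- \<sigma>))"
      by (rule sum_dyadic_square_ge[where A = 1 and B = 1, OF _ _ _ Y hY]) (use \<sigma> in auto)
    moreover have "(\<Sum>(m, n)\<in>{0<..M} \<times> {0<..M}. real_of_int (m\<^sup>2 + n\<^sup>2) powr (- \<sigma>)) \<le>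
        2 * (\<Sum>(m, n)\<in>Y. real_of_int (m\<^sup>2 + n\<^sup>2) powr (- \<sigma>))"
      unfolding Y_def by (rule sum_coprime_pairs_ge) (use \<sigma> in simp)
    ultimately have "64 powr (- \<sigma>) * (\<Sum>j<J. ?q ^ j) * (1 / 2 * (8 powr (- \<sigma>) * (\<Sum>j<J. ?q ^ j))) \<le>
        (\<Sum>(a, b)\<in>X. real_of_int (2 * a * b) powr (- \<sigma>)) * (\<Sum>(m, n)\<in>Y. real_of_int (m\<^sup>2 + n\<^sup>2) powr (- \<sigma>))"
      by (intro mult_mono) (auto intro!: sum_nonneg mult_nonneg_nonneg simp: split_def)
    also have "\<dots> \<le> ?Z"
      using fin by (intro infsum_det_WR_Z2_ge_product \<sigma>) (auto simp: X_def Y_def)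
    also have "64 powr (- \<sigma>) * (\<Sum>j<J. ?q ^ j) * (1 / 2 * (8 powr (- \<sigma>) * (\<Sum>j<J. ?q ^ j))) =
        1 / 2 * (64 * 8) powr (- \<sigma>) * (\<Sum>j<J. ?q ^ j)\<^sup>2"
      by (subst powr_mult) (simp_all add: power2_eq_square)
    finally show ?thesis by simp
  qed
  moreover have "(\<lambda>J. 1 / 2 * 512 powr (- \<sigma>) * (\<Sum>j<J. ?q ^ j)\<^sup>2) \<longlonglongrightarrow>
      1 / 2 * 512 powr (- \<sigma>) * (1 / (1 - ?q))\<^sup>2"
    using q geometric_sums[of ?q] by (intro tendsto_intros) (auto simp: sums_def)
  ultimately show ?thesis by (intro LIMSEQ_le_const2) auto
qed

section \<open>From lattices to Dirichlet coefficients\<close>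

text \<open>Infinitely many lattices of one determinant would make finite sums at exponent 2
  unbounded. Finiteness is needed because \<open>card\<close> is 0 on infinite sets, so
  \<open>WR_count\<close> would otherwise not count.\<close>

lemma finite_WR_Z2_det: "finite {\<Lambda> \<in> WR_Z2. lattice_det \<Lambda> = real (Suc u)}" (is "finite ?F")
proof (rule ccontr)
  assume inf: "infinite ?F"
  define B :: real where "B = 8 powr 2 * (16 / (1 - 4 powr (1 - 2)))\<^sup>2"
  define c where "c = real (Suc u) powr (- 2)"
  have c: "0 < c" by (simp add: c_def)
  obtain n where n: "B < real n * c"
    using reals_Archimedean3[OF c] by blast
  obtain G where G: "finite G" "card G = n" "G \<subseteq> ?F"
    using infinite_arbitrarily_large[OF inf] by blast
  have "(\<Sum>\<Lambda>\<in>G. lattice_det \<Lambda> powr (- 2)) \<le> B"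
    unfolding B_def using G by (intro sum_det_WR_Z2_le) auto
  moreover have "(\<Sum>\<Lambda>\<in>G. lattice_det \<Lambda> powr (- 2)) = (\<Sum>\<Lambda>\<in>G. c)"
    using G(3) by (intro sum.cong refl) (auto simp: c_def)
  ultimately show False using n G(2) by simp
qed

text \<open>Unconditional convergence permits grouping the lattices by determinant. A general field
  covers both the real sums of absolute values and the complex zeta function.\<close>

lemma WR_count_sums:
  fixes h :: "real \<Rightarrow> 'a :: real_normed_field"
  assumes "((\<lambda>\<Lambda>. h (lattice_det \<Lambda>)) has_sum S) WR_Z2"
  shows "(\<lambda>u. of_nat (WR_count (Suc u)) * h (real (Suc u))) sums S"
proof -
  define F where "F u = {\<Lambda> \<in> WR_Z2. lattice_det \<Lambda> = real (Suc u)}" for u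
  have "bij_betw snd (Sigma UNIV F) WR_Z2"
  proof (rule bij_betwI')
    fix v w assume "v \<in> Sigma UNIV F" "w \<in> Sigma UNIV F"
    then show "snd v = snd w \<longleftrightarrow> v = w" by (auto simp: F_def)
  next
    fix \<Lambda> assume "\<Lambda> \<in> WR_Z2"
    then show "\<exists>v\<in>Sigma UNIV F. \<Lambda> = snd v"
      by (rule WR_Z2_det_Suc) (use \<open>\<Lambda> \<in> WR_Z2\<close> in \<open>force simp: F_def\<close>)
  qed (auto simp: F_def)
  then have "((\<lambda>v. h (lattice_det (snd v))) has_sum S) (Sigma UNIV F)"
    using assms has_sum_reindex_bij_betw[of snd "Sigma UNIV F" WR_Z2 "\<lambda>\<Lambda>. h (lattice_det \<Lambda>)"] by simp
  moreover have "((\<lambda>\<Lambda>. h (lattice_det (snd (u, \<Lambda>)))) has_sum of_nat (WR_count (Suc u)) * h (real (Suc u))) (F u)" for u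
  proof -
    have "(\<Sum>\<Lambda>\<in>F u. h (lattice_det \<Lambda>)) = of_nat (WR_count (Suc u)) * h (real (Suc u))"
      by (simp add: F_def WR_count_def)
    moreover have "finite (F u)" unfolding F_def by (rule finite_WR_Z2_det)
    ultimately show ?thesis by (simp add: has_sum_finiteI)
  qed
  ultimately have "((\<lambda>u. of_nat (WR_count (Suc u)) * h (real (Suc u))) has_sum S) UNIV"
    by (rule has_sum_SigmaD)
  then show ?thesis by (rule has_sum_imp_sums)
qed

lemma WR_count_powr_sums:
  fixes \<sigma> :: real
  assumes "1 < \<sigma>"
  shows "(\<lambda>u. real (WR_count (Suc u)) * real (Suc u) powr (- \<sigma>)) sums
    (\<Sum>\<^sub>\<infinity>\<Lambda>\<in>WR_Z2. lattice_det \<Lambda> powr (- \<sigma>))"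
  using WR_count_sums[OF has_sum_infsum[OF det_powr_summable_on_WR_Z2[OF assms]]] by simp

text \<open>\<open>zeta_WR\<close> is an \<open>infsum\<close>, whose default value is 0 when
  summability fails; the first claim shows that this does not occur here.\<close>

lemma zeta_WR_sums:
  assumes "1 < Re s"
  shows "(\<lambda>\<Lambda>. of_real (lattice_det \<Lambda>) powr (- s) :: complex) summable_on WR_Z2"
    and "(\<lambda>u. of_nat (WR_count (Suc u)) * of_nat (Suc u) powr (- s)) sums zeta_WR s"
proof -
  have norm: "cmod (of_real (lattice_det \<Lambda>) powr (- s)) = lattice_det \<Lambda> powr (- Re s)"
    if "\<Lambda> \<in> WR_Z2" for \<Lambda>
    using that by (rule WR_Z2_det_Suc) (simp add: norm_powr_real_powr)
  show summable: "(\<lambda>\<Lambda>. of_real (lattice_det \<Lambda>) powr (- s) :: complex) summable_on WR_Z2"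
  proof (rule abs_summable_summable)
    show "(\<lambda>\<Lambda>. cmod (of_real (lattice_det \<Lambda>) powr (- s))) summable_on WR_Z2"
      using det_powr_summable_on_WR_Z2[OF assms] by (simp add: norm cong: summable_on_cong)
  qed
  show "(\<lambda>u. of_nat (WR_count (Suc u)) * of_nat (Suc u) powr (- s)) sums zeta_WR s"
    using WR_count_sums[where h = "\<lambda>d. of_real d powr (- s)", OF has_sum_infsum[OF summable]]
    by (simp add: zeta_WR_def)
qed

text \<open>Weierstrass comparison: on a disk reaching halfway to the line \<open>Re s = 1\<close>,
  the terms are dominated by those at the real exponent \<open>\<sigma> = (1 + Re s) / 2\<close>,
  where the series converges.\<close>

lemma zeta_WR_analytic: "zeta_WR analytic_on {s. Re s > 1}"
proof -
  define f where "f u s = of_nat (WR_count (Suc u)) * of_nat (Suc u) powr (- s)" for u and s :: complex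
  have "open {s. 1 < Re s}" by (rule open_halfspace_Re_gt)
  moreover have "f u field_differentiable at s" for u s
  proof -
    have "f u holomorphic_on UNIV"
      unfolding f_def by (intro holomorphic_intros)
    then show ?thesis by (rule holomorphic_on_imp_differentiable_at) simp_all
  qed
  moreover have "\<exists>d h. 0 < d \<and> summable h \<and> range h \<subseteq> \<real>\<^sub>\<ge>\<^sub>0 \<and>
      (\<forall>\<^sub>F n in sequentially. \<forall>y\<in>ball s d \<inter> {s. 1 < Re s}. cmod (f n y) \<le> cmod (h n))"
    if "s \<in> {s. 1 < Re s}" for s
  proof -
    define \<sigma> where "\<sigma> = (1 + Re s) / 2"
    define h where "h u = real (WR_count (Suc u)) * real (Suc u) powr (- \<sigma>)" for u
    have \<sigma>: "1 < \<sigma>" "\<sigma> < Re s" using that by (auto simp: \<sigma>_def)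
    have "summable h"
      unfolding h_def using WR_count_powr_sums[OF \<sigma>(1)] by (rule sums_summable)
    moreover have "cmod (f u y) \<le> h u" if "y \<in> ball s (Re s - \<sigma>)" for u y
    proof -
      have "\<bar>Re (s - y)\<bar> < Re s - \<sigma>"
        using that abs_Re_le_cmod[of "s - y"] by (simp add: dist_norm)
      then have "\<sigma> \<le> Re y" by simp
      then show ?thesis
        unfolding f_def h_def norm_mult norm_nat_powr by (auto intro!: mult_left_mono powr_mono)
    qed
    moreover have "0 \<le> h u" for u by (simp add: h_def)
    ultimately show ?thesis
      using \<sigma> by (intro exI[of _ "Re s - \<sigma>"] exI[of _ "\<lambda>u. complex_of_real (h u)"])
        (auto simp: summable_of_real)
  qed
  ultimately obtain g where g: "\<forall>s\<in>{s. 1 < Re s}. (\<lambda>n. f n s) sums g s \<and> g field_differentiable at s"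
    by (rule series_differentiable_comparison_complex)
  have "g s = zeta_WR s" if "s \<in> {s. 1 < Re s}" for s
    using g that zeta_WR_sums(2)[of s] by (auto simp: f_def dest: sums_unique2)
  moreover have "g holomorphic_on {s. 1 < Re s}"
    using g by (auto simp: holomorphic_on_def intro: field_differentiable_at_within)
  ultimately have "zeta_WR holomorphic_on {s. 1 < Re s}"
    by (rule holomorphic_transform[rotated])
  then show ?thesis
    by (simp add: analytic_on_open open_halfspace_Re_gt)
qed

section \<open>Comparison with the model series\<close>

lemma dirichlet_abs_sum_WR_count:
  assumes "1 < Re s"
  shows "dirichlet_abs_sum (\<lambda>u. of_nat (WR_count u)) s =
    ennreal (\<Sum>\<^sub>\<infinity>\<Lambda>\<in>WR_Z2. lattice_det \<Lambda> powr (- Re s))"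
  unfolding dirichlet_abs_sum_def norm_mult norm_nat_powr norm_of_nat
  using WR_count_powr_sums[OF assms] by (intro suminf_ennreal_eq) auto

text \<open>Termwise comparison works because every determinant is at least 1.\<close>

lemma infsum_det_WR_Z2_antimono:
  fixes \<sigma> \<tau> :: real
  assumes "1 < \<sigma>" "\<sigma> \<le> \<tau>"
  shows "(\<Sum>\<^sub>\<infinity>\<Lambda>\<in>WR_Z2. lattice_det \<Lambda> powr (- \<tau>)) \<le> (\<Sum>\<^sub>\<infinity>\<Lambda>\<in>WR_Z2. lattice_det \<Lambda> powr (- \<sigma>))"
proof (intro infsum_mono det_powr_summable_on_WR_Z2)
  fix \<Lambda> assume "\<Lambda> \<in> WR_Z2"
  then obtain u where "lattice_det \<Lambda> = real (Suc u)" by (rule WR_Z2_det_Suc)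
  then show "lattice_det \<Lambda> powr (- \<tau>) \<le> lattice_det \<Lambda> powr (- \<sigma>)"
    using assms by (intro powr_mono) auto
qed (use assms in auto)

lemma infsum_det_WR_Z2_le:
  fixes \<sigma> \<mu> :: real
  assumes "1 < \<sigma>" "2 \<le> \<mu>"
  shows "(\<Sum>\<^sub>\<infinity>\<Lambda>\<in>WR_Z2. lattice_det \<Lambda> powr (- \<sigma>)) \<le> 65536 * (1 - 2 powr (1 - \<sigma>)) powr (- \<mu>)"
proof -
  define t where "t = (2::real) powr (1 - \<sigma>)"
  have t: "0 < t" "t < 1"
    using assms powr_less_mono[of "1 - \<sigma>" 0 2] by (auto simp: t_def)
  \<comment> \<open>The factor \<open>8 powr \<sigma>\<close> is unbounded, while the comparison
    must hold on the whole half plane; capping the exponent at 2 keeps the factor at most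
    64.\<close>
  define \<tau> where "\<tau> = min \<sigma> 2"
  define t' where "t' = (2::real) powr (1 - \<tau>)"
  have \<tau>: "1 < \<tau>" "\<tau> \<le> \<sigma>" "\<tau> \<le> 2" using assms by (auto simp: \<tau>_def)
  have t': "0 < t'" "t' < 1"
    using \<tau> powr_less_mono[of "1 - \<tau>" 0 2] by (auto simp: t'_def)
  have four: "4 powr (1 - \<tau>) = t'\<^sup>2"
    using powr_mult[of 2 2 "1 - \<tau>"] by (simp add: t'_def power2_eq_square)
  have "(1 - t) / 2 \<le> 1 - t'"
  proof (cases "\<sigma> \<le> 2")
    case True
    then show ?thesis using t by (simp add: \<tau>_def t_def t'_def)
  next
    case False
    then have "t' = 1 / 2" by (simp add: \<tau>_def t'_def powr_minus_divide)
    with t show ?thesis by simp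
  qed
  also have "1 - t' \<le> 1 - t'\<^sup>2"
    using t' mult_left_le_one_le[of t' t'] by (simp add: power2_eq_square)
  finally have le: "(1 - t) / 2 \<le> 1 - t'\<^sup>2" .
  have "(\<Sum>\<^sub>\<infinity>\<Lambda>\<in>WR_Z2. lattice_det \<Lambda> powr (- \<sigma>)) \<le> (\<Sum>\<^sub>\<infinity>\<Lambda>\<in>WR_Z2. lattice_det \<Lambda> powr (- \<tau>))"
    using \<tau> by (intro infsum_det_WR_Z2_antimono)
  also have "\<dots> \<le> 8 powr \<tau> * (16 / (1 - 4 powr (1 - \<tau>)))\<^sup>2"
    using \<tau> by (intro infsum_le_finite_sums det_powr_summable_on_WR_Z2 sum_det_WR_Z2_le)
  also have "\<dots> \<le> 8 powr 2 * (16 / ((1 - t) / 2))\<^sup>2"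
    unfolding four using \<tau> t le by (intro mult_mono powr_mono power_mono divide_left_mono) auto
  \<comment> \<open>\<open>64 * 32\<^sup>2 = 65536\<close>.\<close>
  also have "\<dots> = 65536 * (1 - t) powr (- 2)"
    using t by (simp add: powr_minus_divide power_divide)
  \<comment> \<open>As \<open>1 - t\<close> lies between 0 and 1, raising the order from 2 to
    \<open>\<mu>\<close> only enlarges the bound.\<close>
  also have "\<dots> \<le> 65536 * (1 - t) powr (- \<mu>)"
    using t assms by (intro mult_left_mono powr_mono') auto
  finally show ?thesis by (simp add: t_def)
qed

text \<open>Passes from ratio 4 to the ratio 2 of the model series through
  \<open>1 - t\<^sup>2 \<le> 2 * (1 - t)\<close>, at the cost of a factor
  \<open>1 / 4\<close>.\<close>

lemma infsum_det_WR_Z2_ge':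
  fixes \<sigma> :: real
  assumes "1 < \<sigma>"
  shows "1 / 8 * 512 powr (- \<sigma>) * (1 - 2 powr (1 - \<sigma>)) powr (- 2) \<le>
    (\<Sum>\<^sub>\<infinity>\<Lambda>\<in>WR_Z2. lattice_det \<Lambda> powr (- \<sigma>))"
proof -
  define t where "t = (2::real) powr (1 - \<sigma>)"
  have t: "0 < t" "t < 1"
    using assms powr_less_mono[of "1 - \<sigma>" 0 2] by (auto simp: t_def)
  have four: "4 powr (1 - \<sigma>) = t\<^sup>2"
    using powr_mult[of 2 2 "1 - \<sigma>"] by (simp add: t_def power2_eq_square)
  have pos: "0 < 1 - t\<^sup>2" using t by (simp add: abs_square_less_1)
  have "1 - t\<^sup>2 \<le> 2 * (1 - t)"
    using zero_le_power2[of "1 - t"] by (simp add: power2_eq_square algebra_simps)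
  then have "(1 / (2 * (1 - t)))\<^sup>2 \<le> (1 / (1 - t\<^sup>2))\<^sup>2"
    using t pos by (intro power_mono divide_left_mono) auto
  moreover have "(1 / (2 * (1 - t)))\<^sup>2 = 1 / 4 * (1 - t) powr (- 2)"
    unfolding power_divide power_mult_distrib using t by (simp add: powr_minus_divide)
  ultimately have "1 / 2 * 512 powr (- \<sigma>) * (1 / 4 * (1 - t) powr (- 2)) \<le>
      1 / 2 * 512 powr (- \<sigma>) * (1 / (1 - t\<^sup>2))\<^sup>2"
    by (intro mult_left_mono) auto
  also have "\<dots> \<le> (\<Sum>\<^sub>\<infinity>\<Lambda>\<in>WR_Z2. lattice_det \<Lambda> powr (- \<sigma>))"
    using infsum_det_WR_Z2_ge[OF assms] by (simp only: four)
  finally show ?thesis by (simp add: t_def)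
qed

theorem theorem1p5:
  shows
    "(\<forall>s. Re s > 1 \<longrightarrow>
        (\<lambda>\<Lambda>. of_real (lattice_det \<Lambda>) powr (- s) :: complex) summable_on WR_Z2 \<and>
        (\<lambda>u. of_nat (WR_count (Suc u)) * of_nat (Suc u) powr (- s)) sums zeta_WR s) \<and>
     zeta_WR analytic_on {s. Re s > 1} \<and>
     (\<exists>b. dirichlet_pole b 2 1 \<and>
        dirichlet_bounded_below (\<lambda>u. of_nat (WR_count u)) b) \<and>
     (\<forall>\<epsilon>::real. \<epsilon> > 0 \<longrightarrow>
        (\<exists>b. dirichlet_pole b (2 + \<epsilon>) 1 \<and>
           dirichlet_bounded_above (\<lambda>u. of_nat (WR_count u)) b))"
proof (intro conjI allI impI)
  show "\<exists>b. dirichlet_pole b 2 1 \<and> dirichlet_bounded_below (\<lambda>u. of_nat (WR_count u)) b"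
  proof (intro exI conjI)
    \<comment> \<open>With \<open>c = 512\<close> and \<open>K = 1 / 8\<close> the sum of absolute
      values is exactly the left side of \<open>infsum_det_WR_Z2_ge'\<close>.\<close>
    show "dirichlet_pole (\<lambda>n. of_real (pole_coeff 512 (1 / 8) 2 n)) 2 1"
      by (rule dirichlet_pole_pole_coeff) auto
    show "dirichlet_bounded_below (\<lambda>u. of_nat (WR_count u)) (\<lambda>n. of_real (pole_coeff 512 (1 / 8) 2 n))"
      unfolding dirichlet_bounded_below_def
      using infsum_det_WR_Z2_ge'
      by (auto simp: dirichlet_abs_sum_WR_count dirichlet_abs_sum_pole_coeff intro!: ennreal_leI)
  qed
  fix \<epsilon> :: real
  assume "\<epsilon> > 0"
  show "\<exists>b. dirichlet_pole b (2 + \<epsilon>) 1 \<and> dirichlet_bounded_above (\<lambda>u. of_nat (WR_count u)) b"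
  proof (intro exI conjI)
    \<comment> \<open>With \<open>c = 1\<close> and \<open>K = 65536\<close> it is the right side of
      \<open>infsum_det_WR_Z2_le\<close> at order \<open>2 + \<epsilon>\<close>.\<close>
    show "dirichlet_pole (\<lambda>n. of_real (pole_coeff 1 65536 (2 + \<epsilon>) n)) (2 + \<epsilon>) 1"
      using \<open>\<epsilon> > 0\<close> by (intro dirichlet_pole_pole_coeff) auto
    show "dirichlet_bounded_above (\<lambda>u. of_nat (WR_count u)) (\<lambda>n. of_real (pole_coeff 1 65536 (2 + \<epsilon>) n))"
      unfolding dirichlet_bounded_above_def
      using infsum_det_WR_Z2_le[of _ "2 + \<epsilon>"] \<open>\<epsilon> > 0\<close>
      by (auto simp: dirichlet_abs_sum_WR_count dirichlet_abs_sum_pole_coeff intro!: ennreal_leI)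
  qed
qed (use zeta_WR_sums zeta_WR_analytic in auto)

end
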